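(* Let $r\in(0,1)$. There exists a compact packing of the plane using discs of radius $1$ and $r$ (with discs of both radii present) if and only if $r\in\{c_1,c_2,\dots,c_9\}$, where - $c_1\approx 0.6375559772$ is the unique root in $(0,1)$ of $r^4-10r^2-8r+9=0$; - $c_2\approx 0.5451510421$ is the unique root in $(1/2,3/5)$ of $(7+4\sqrt3)r^4+(20+12\sqrt3)r^3+(6+4\sqrt3)r^2+(-20-4\sqrt3)r+3=0$; - $c_3\approx 0.5332964167$ is the unique root in $(0,1)$ of $8r^3+3r^2-2r-1=0$; - $c_4=\sqrt2-1$; - $c_5=\bigl(2\sqrt3+1-2\sqrt{1+\sqrt3}\bigr)/3$; - $c_6=\sin(\pi/12)/(1-\sin(\pi/12))$; - $c_7=(\sqrt{17}-3)/4$; - $c_8=2\sqrt3/3-1$; - $c_9=5-2\sqrt6$.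
   Context: A packing of the plane is a collection of closed discs in $\mathbb{R}^2$ with pairwise disjoint interiors. A packing is compact if for every disc $D$ of the packing, the discs of the packing tangent to $D$, listed in cyclic order around $D$ as $D_1,\dots,D_n$ (with $D_{n+1}=D_1$), are such that $D_i$ is tangent to $D_{i+1}$ for $i=1,\dots,n$, and this chain surrounds $D$: the angles, in $(0,\pi)$, at the centre of $D$ in the triangles with vertices the centres of $D,D_i,D_{i+1}$ sum to $2\pi$. A compact packing using discs of radius $1$ and $r$ is a compact packing in which every disc has radius $1$ or $r$ and discs of both radii occur. *)

theory Defs
  imports "HOL-Analysis.Analysis"
begin

text \<open>The Euclidean plane is the type of complex numbers.  A closed disc of positive radius
  is represented by its centre and radius, which it determines.\<close>

type_synonym disc = "complex \<times> real"

abbreviation centre :: "disc \<Rightarrow> complex" where "centre \<equiv> fst"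

abbreviation radius :: "disc \<Rightarrow> real" where "radius \<equiv> snd"

definition region :: "disc \<Rightarrow> complex set" where
  "region D = cball (centre D) (radius D)"

definition packing :: "disc set \<Rightarrow> bool" where
  "packing P \<longleftrightarrow> (\<forall>D\<in>P. radius D > 0) \<and>
     pairwise (\<lambda>D E. interior (region D) \<inter> interior (region E) = {}) P"

text \<open>Discs with disjoint interiors can only be tangent externally.\<close>

definition tangent :: "disc \<Rightarrow> disc \<Rightarrow> bool" where
  "tangent D E \<longleftrightarrow> dist (centre D) (centre E) = radius D + radius E"

definition angle_at :: "complex \<Rightarrow> complex \<Rightarrow> complex \<Rightarrow> real" where
  "angle_at p a b = arccos (((a - p) \<bullet> (b - p)) / (norm (a - p) * norm (b - p)))"

text \<open>Going round \<open>p\<close> once counterclockwise, starting at the first point of the list,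
  one meets the listed points in turn; \<open>\<theta>\<close> gives their polar angles about \<open>p\<close>.\<close>

definition cyclically_ordered :: "complex \<Rightarrow> complex list \<Rightarrow> bool" where
  "cyclically_ordered p zs \<longleftrightarrow> (\<exists>\<theta> :: nat \<Rightarrow> real.
     (\<forall>i < length zs. zs ! i = p + rcis (dist p (zs ! i)) (\<theta> i)) \<and>
     (\<forall>j < length zs. \<forall>i < j. \<theta> i < \<theta> j \<and> \<theta> j < \<theta> i + 2 * pi))"

text \<open>Indices are taken modulo the length of the list, so the successor of the last disc is
  the first one.  If discs of positive radius are mutually tangent, their centres form a
  nondegenerate triangle, so each angle below lies strictly between \<open>0\<close> and \<open>pi\<close>.\<close>

definition surrounded :: "disc set \<Rightarrow> disc \<Rightarrow> bool" where
  "surrounded P D \<longleftrightarrow> (\<exists>Ds.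
     distinct Ds \<and> set Ds = {E \<in> P. tangent D E} \<and>
     cyclically_ordered (centre D) (map centre Ds) \<and>
     (\<forall>i < length Ds. tangent (Ds ! i) (Ds ! (Suc i mod length Ds))) \<and>
     (\<Sum>i < length Ds.
        angle_at (centre D) (centre (Ds ! i)) (centre (Ds ! (Suc i mod length Ds)))) = 2 * pi)"

definition compact_packing :: "disc set \<Rightarrow> bool" where
  "compact_packing P \<longleftrightarrow> packing P \<and> (\<forall>D\<in>P. surrounded P D)"

definition compact_packing_using :: "real \<Rightarrow> real \<Rightarrow> disc set \<Rightarrow> bool" where
  "compact_packing_using s r P \<longleftrightarrow> compact_packing P \<and> radius ` P = {s, r}"

definition c1_root :: "real \<Rightarrow> bool" where
  "c1_root x \<longleftrightarrow> x \<in> {0<..<1} \<and> x^4 - 10 * x^2 - 8 * x + 9 = 0"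

definition c2_root :: "real \<Rightarrow> bool" where
  "c2_root x \<longleftrightarrow> x \<in> {1/2<..<3/5} \<and>
     (7 + 4 * sqrt 3) * x^4 + (20 + 12 * sqrt 3) * x^3 + (6 + 4 * sqrt 3) * x^2
       + (- 20 - 4 * sqrt 3) * x + 3 = 0"

definition c3_root :: "real \<Rightarrow> bool" where
  "c3_root x \<longleftrightarrow> x \<in> {0<..<1} \<and> 8 * x^3 + 3 * x^2 - 2 * x - 1 = 0"

definition c1 :: real where "c1 = (THE x. c1_root x)"

definition c2 :: real where "c2 = (THE x. c2_root x)"

definition c3 :: real where "c3 = (THE x. c3_root x)"

definition c4 :: real where "c4 = sqrt 2 - 1"

definition c5 :: real where "c5 = (2 * sqrt 3 + 1 - 2 * sqrt (1 + sqrt 3)) / 3"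

definition c6 :: real where "c6 = sin (pi / 12) / (1 - sin (pi / 12))"

definition c7 :: real where "c7 = (sqrt 17 - 3) / 4"

definition c8 :: real where "c8 = 2 * sqrt 3 / 3 - 1"

definition c9 :: real where "c9 = 5 - 2 * sqrt 6"

end

(* Necessity: let a small disc touch a large one.  The angles of the triangles around it are
   alpha > beta > pi/3 or pi/3, so it has at most five neighbours, and the equation
   a alpha + b beta + c pi/3 = 2 pi leaves ten possible coronas; since alpha and beta are explicit
   functions of r, each of them determines r.  Nine of these values are c1, ..., c9.  The tenth
   corona, five large discs, is impossible: then no two small neighbours of a large disc would be
   adjacent, so its corona would have angles pi/3 and 3 pi/10 only, and 10 x + 9 y = 60 forces y = 0.
   A small disc touching a large one exists, for otherwise every small disc sits in a hexagon of
   small discs, and one can step from small disc to small disc towards a large disc forever, the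
   squared distance decreasing by at least 2 r (1 - r) each time.
   Sufficiency: for each value there is a doubly periodic packing with two to nine discs per cell. *)
theory Submission
  imports Defs
begin

section \<open>Coronas listed counterclockwise\<close>

text \<open>The definition of \<open>surrounded\<close> asks for polar angles and a sum of
  arccosines, which are awkward to compute for algebraic radii. The constructions avoid computing
  any angle: if each neighbour is reached from the preceding one by a counterclockwise turn of less
  than pi, and a fixed ray is crossed only in the closing step, then the angles telescope to 2 pi.
  This condition and the separation of non-tangent discs are strict inequalities, so rounded integer
  coordinates can decide them. Tangency is an equality and is the only matter left to exact algebra.
  Periodicity makes the checks finite, with a determinant bound disposing of distant lattice
  translates. In the other direction one trigonometric identity turns each angle equation into a
  polynomial one. Squaring may add roots: \<open>p2\<close> has another root in (0, 1/2), so for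
  \<open>c2\<close> the radius has to be located separately. Nor is the search for a contact a
  formality: the packing for \<open>c5\<close> contains small discs all of whose neighbours are
  small.\<close>

lemma sin_pos_gap:
  fixes x :: real
  assumes "sin x > 0" "- 2 * pi < x" "x < 2 * pi"
  shows "0 < x \<and> x < pi \<or> x < - pi"
proof (rule ccontr)
  assume "\<not> ?thesis"
  hence "x \<ge> pi \<or> - pi \<le> x \<and> x \<le> 0" by linarith
  thus False
  proof
    assume "x \<ge> pi"
    hence "sin (2 * pi - x) \<ge> 0" using assms by (intro sin_ge_zero) auto
    thus False using assms by (simp add: sin_diff)
  next
    assume "- pi \<le> x \<and> x \<le> 0"
    hence "sin (- x) \<ge> 0" by (intro sin_ge_zero) auto
    thus False using assms by simp
  qed
qed

lemma Im_cnj_mult_polar: "Im (cnj (rcis a s) * rcis b t) = a * b * sin (t - s)"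
  by (simp add: rcis_def sin_diff algebra_simps)

lemma inner_polar: "rcis a s \<bullet> rcis b t = a * b * cos (t - s)"
  by (simp add: rcis_def inner_complex_def cos_diff algebra_simps)

text \<open>A counterclockwise turn of less than pi raises \<open>Arg2pi\<close> unless it crosses
  the positive real axis. Such a crossing leads from the lower to the upper half-plane, which the
  third hypothesis excludes.\<close>

lemma Arg2pi_ccw:
  assumes "Im a \<noteq> 0" "Im b \<noteq> 0" "Im a > 0 \<or> Im b < 0" "Im (cnj a * b) > 0"
  shows "Arg2pi a < Arg2pi b \<and> Arg2pi b - Arg2pi a < pi"
proof -
  have polar: "z = rcis (norm z) (Arg2pi z)" for z
    using Arg2pi_eq[of z] by (simp add: rcis_def cis_conv_exp)
  have n: "norm a > 0" "norm b > 0" using assms by auto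
  have "norm a * norm b * sin (Arg2pi b - Arg2pi a) > 0"
    using assms(4) polar[of a] polar[of b] Im_cnj_mult_polar by metis
  hence "sin (Arg2pi b - Arg2pi a) > 0" using n by (metis mult_pos_pos zero_less_mult_pos)
  moreover have "0 \<le> Arg2pi a" "Arg2pi a < 2*pi" "0 \<le> Arg2pi b" "Arg2pi b < 2*pi"
    by (auto simp: Arg2pi_ge_0 Arg2pi_lt_2pi)
  ultimately have *: "0 < Arg2pi b - Arg2pi a \<and> Arg2pi b - Arg2pi a < pi \<or> Arg2pi b - Arg2pi a < - pi"
    by (intro sin_pos_gap) auto
  have "\<not> Arg2pi b - Arg2pi a < - pi"
  proof
    assume "Arg2pi b - Arg2pi a < - pi"
    hence "Arg2pi a > pi" "Arg2pi b < pi"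
      using Arg2pi_ge_0[of b] Arg2pi_lt_2pi[of a] by linarith+
    moreover have "Im a \<le> 0" if "Arg2pi a > pi"
      using that Arg2pi_le_pi[of a] by linarith
    moreover have "Im b \<ge> 0" if "Arg2pi b < pi"
      using that Arg2pi_le_pi[of b] by linarith
    ultimately show False using assms by linarith
  qed
  with * show ?thesis by linarith
qed

text \<open>Multiplication by \<open>c\<close> turns the ray through \<open>cnj c\<close> onto the
  cut of \<open>Arg2pi\<close>. By \<open>half\<close> no step except the closing one crosses this
  ray, so the polar angles increase along the list. Each arccosine equals the difference of two
  consecutive polar angles, and these differences telescope.\<close>

lemma ring_angles:
  fixes ws :: "complex list" and c :: complex
  defines "n \<equiv> length ws"
  assumes n: "n > 0"
    and off: "\<And>i. i < n \<Longrightarrow> Im (ws ! i * c) \<noteq> 0"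
    and half: "\<And>i. Suc i < n \<Longrightarrow> Im (ws ! i * c) > 0 \<or> Im (ws ! Suc i * c) < 0"
    and ccw: "\<And>i. i < n \<Longrightarrow> Im (cnj (ws ! i) * ws ! (Suc i mod n)) > 0"
  obtains \<theta> :: "nat \<Rightarrow> real"
  where "\<And>i. i < n \<Longrightarrow> ws ! i = rcis (norm (ws ! i)) (\<theta> i)"
    and "\<And>i j. j < n \<Longrightarrow> i < j \<Longrightarrow> \<theta> i < \<theta> j \<and> \<theta> j < \<theta> i + 2 * pi"
    and "(\<Sum>i<n. arccos (ws ! i \<bullet> ws ! (Suc i mod n) /
            (norm (ws ! i) * norm (ws ! (Suc i mod n))))) = 2 * pi"
proof -
  have c: "c \<noteq> 0" using off[of 0] n by auto
  define \<theta> where "\<theta> i = Arg2pi (ws ! i * c) - Arg2pi c" for i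
  have polar: "z = rcis (norm z) (Arg2pi z)" for z
    using Arg2pi_eq[of z] by (simp add: rcis_def cis_conv_exp)
  have rc: "ws ! i = rcis (norm (ws ! i)) (\<theta> i)" for i
  proof -
    have "ws ! i = (ws ! i * c) / c" using c by simp
    also have "\<dots> = rcis (norm (ws ! i * c)) (Arg2pi (ws ! i * c)) / rcis (norm c) (Arg2pi c)"
      using polar by metis
    also have "\<dots> = rcis (norm (ws ! i)) (\<theta> i)"
      using c by (simp add: rcis_divide \<theta>_def norm_mult)
    finally show ?thesis .
  qed
  have nz: "norm (ws ! i) > 0" if "i < n" for i using off[OF that] by auto
  have cc: "Im (cnj (a * c) * (b * c)) = (norm c)^2 * Im (cnj a * b)" for a b
  proof -
    have "cnj (a * c) * (b * c) = (cnj a * b) * (c * cnj c)" by (simp add: mult_ac)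
    also have "c * cnj c = of_real ((norm c)^2)" by (metis complex_norm_square)
    also have "Im ((cnj a * b) * of_real x) = x * Im (cnj a * b)" for x
      by (simp add: algebra_simps)
    finally show ?thesis .
  qed
  have step: "\<theta> i < \<theta> (Suc i) \<and> \<theta> (Suc i) - \<theta> i < pi" if "Suc i < n" for i
    unfolding \<theta>_def
    using Arg2pi_ccw[of "ws ! i * c" "ws ! Suc i * c"] off[of i] off[of "Suc i"] half[OF that]
      ccw[of i] that c cc[of "ws ! i" "ws ! Suc i"] by (auto simp: mod_less)
  have mono: "\<theta> i < \<theta> j" if "j < n" "i < j" for i j
    using that(2,1) by (induction j) (auto simp: less_Suc_eq dest: step intro: less_trans)
  have bd: "\<theta> j < \<theta> i + 2 * pi" for i j
    using Arg2pi_ge_0[of "ws ! i * c"] Arg2pi_lt_2pi[of "ws ! j * c"] by (simp add: \<theta>_def)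
  have arc: "arccos (ws ! i \<bullet> ws ! j / (norm (ws ! i) * norm (ws ! j))) = x"
    if "i < n" "j < n" "cos x = cos (\<theta> j - \<theta> i)" "0 \<le> x" "x \<le> pi" for i j x
  proof -
    have "ws ! i \<bullet> ws ! j = norm (ws ! i) * norm (ws ! j) * cos x"
      using inner_polar rc[of i] rc[of j] that(3) by metis
    moreover have "arccos (cos x) = x" using that(4,5) by (simp add: arccos_cos)
    ultimately show ?thesis using nz[OF that(1)] nz[OF that(2)] by simp
  qed
  obtain k where k: "n = Suc k" using n by (cases n) auto
  \<comment> \<open>The closing step has positive sine although the angle does not increase. It is
    therefore the turn across the cut, and 2 pi must be added to \<open>\<theta> 0\<close>.\<close>
  have l: "0 < \<theta> 0 + 2 * pi - \<theta> k \<and> \<theta> 0 + 2 * pi - \<theta> k < pi"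
  proof -
    have "Im (cnj (ws ! k) * ws ! 0) > 0" using ccw[of k] k by simp
    hence "norm (ws ! k) * norm (ws ! 0) * sin (\<theta> 0 - \<theta> k) > 0"
      using rc[of k] rc[of 0] Im_cnj_mult_polar by metis
    hence "sin (\<theta> 0 - \<theta> k) > 0"
      using nz[of k] nz[of 0] k by (metis lessI mult_pos_pos zero_less_Suc zero_less_mult_pos)
    moreover have "\<theta> 0 \<le> \<theta> k" using mono[of k 0] k by (cases k) (auto simp: less_imp_le)
    ultimately show ?thesis using sin_pos_gap[of "\<theta> 0 - \<theta> k"] bd[of k 0] pi_gt_zero by linarith
  qed
  have "(\<Sum>i<n. arccos (ws ! i \<bullet> ws ! (Suc i mod n) / (norm (ws ! i) * norm (ws ! (Suc i mod n)))))
    = (\<Sum>i<k. arccos (ws ! i \<bullet> ws ! Suc i / (norm (ws ! i) * norm (ws ! Suc i))))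
      + arccos (ws ! k \<bullet> ws ! 0 / (norm (ws ! k) * norm (ws ! 0)))"
    unfolding k by simp
  also have "(\<Sum>i<k. arccos (ws ! i \<bullet> ws ! Suc i / (norm (ws ! i) * norm (ws ! Suc i))))
    = (\<Sum>i<k. \<theta> (Suc i) - \<theta> i)"
    by (intro sum.cong arc) (use step k in \<open>auto simp: less_imp_le\<close>)
  also have "\<dots> = \<theta> k - \<theta> 0" by (rule sum_lessThan_telescope)
  also have "arccos (ws ! k \<bullet> ws ! 0 / (norm (ws ! k) * norm (ws ! 0))) = \<theta> 0 + 2 * pi - \<theta> k"
  proof (rule arc)
    show "cos (\<theta> 0 + 2 * pi - \<theta> k) = cos (\<theta> 0 - \<theta> k)"
      using cos_periodic[of "\<theta> 0 - \<theta> k"] by (simp add: algebra_simps)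
  qed (use l k in auto)
  finally show ?thesis using that[of \<theta>] rc mono bd by auto
qed

section \<open>Doubly periodic packings\<close>

text \<open>In a packing with lattice generated by \<open>u\<close> and \<open>v\<close>, the label \<open>(k, m, n)\<close> stands for the translate
  of the base disc number \<open>k\<close> by \<open>m u + n v\<close>.\<close>

type_synonym label = "nat \<times> int \<times> int"

definition offset :: "complex \<Rightarrow> complex \<Rightarrow> disc list \<Rightarrow> nat \<Rightarrow> label \<Rightarrow> complex" where
  "offset u v ds k = (\<lambda>(l, m, n).
     centre (ds ! l) - centre (ds ! k) + of_int m * u + of_int n * v)"

definition site :: "complex \<Rightarrow> complex \<Rightarrow> disc list \<Rightarrow> label \<Rightarrow> disc" where
  "site u v ds = (\<lambda>(k, m, n). (centre (ds ! k) + of_int m * u + of_int n * v, radius (ds ! k)))"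

definition periodic :: "complex \<Rightarrow> complex \<Rightarrow> disc list \<Rightarrow> disc set" where
  "periodic u v ds = site u v ds ` {(k, m, n). k < length ds}"

text \<open>The arrangement of a periodic packing is verified on coordinates scaled by \<open>1000\<close> and
  rounded to integers.  A rounding error of at most \<open>1\<close> per coordinate of a centre or lattice vector
  gives an error of at most \<open>6\<close> per coordinate of an offset with lattice coefficients in
  \<open>{-2..2}\<close>, hence at most \<open>12\<close> in norm.  Only the tangencies need exact arithmetic.\<close>

definition approx :: "complex \<Rightarrow> int \<times> int \<Rightarrow> bool" where
  "approx z Z \<longleftrightarrow> \<bar>1000 * Re z - of_int (fst Z)\<bar> \<le> 1 \<and> \<bar>1000 * Im z - of_int (snd Z)\<bar> \<le> 1"

definition aoffset :: "int \<times> int \<Rightarrow> int \<times> int \<Rightarrow> ((int \<times> int) \<times> int) list \<Rightarrow> nat \<Rightarrow> label \<Rightarrow> int \<times> int" where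
  "aoffset U V as k = (\<lambda>(l, m, n).
     (fst (fst (as ! l)) - fst (fst (as ! k)) + m * fst U + n * fst V,
      snd (fst (as ! l)) - snd (fst (as ! k)) + m * snd U + n * snd V))"

definition l1norm :: "int \<times> int \<Rightarrow> int" where "l1norm Z = \<bar>fst Z\<bar> + \<bar>snd Z\<bar>"

definition cross :: "int \<times> int \<Rightarrow> int \<times> int \<Rightarrow> int" where
  "cross Z W = fst Z * snd W - snd Z * fst W"

text \<open>An inequality between rounded numbers cannot certify a tangency, so listed neighbours
  are exempt here; their distances are settled exactly through \<open>edges\<close>.\<close>

definition sep_check :: "int \<times> int \<Rightarrow> int \<times> int \<Rightarrow> ((int \<times> int) \<times> int) list \<Rightarrow> label list list \<Rightarrow> nat \<Rightarrow> bool" where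
  "sep_check U V as nb k \<longleftrightarrow> (\<forall>l\<in>set [0..<length as]. \<forall>m\<in>set [-2..2]. \<forall>n\<in>set [-2..2].
     (let Z = aoffset U V as k (l, m, n) in
      (snd (as ! k) + snd (as ! l) + 12)^2 < (fst Z)^2 + (snd Z)^2 \<or>
      (l, m, n) \<in> set (nb ! k) \<or> (l, m, n) = (k, 0, 0)))"

text \<open>Rules out contacts between translates with a lattice coefficient of absolute value at
  least 3. \<open>B\<close> bounds the scaled length of the lattice vector between two discs in
  contact, where 4 is the rounding error of a difference of two centres. The bracket in
  \<open>D\<close> bounds the scaled lattice determinant from below, using
  \<open>cross_error\<close> with \<open>e = 1\<close>.\<close>

definition tail_check :: "int \<times> int \<Rightarrow> int \<times> int \<Rightarrow> ((int \<times> int) \<times> int) list \<Rightarrow> nat \<Rightarrow> bool" where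
  "tail_check U V as k \<longleftrightarrow> (\<forall>l\<in>set [0..<length as].
     (let B = snd (as ! k) + snd (as ! l) + l1norm (aoffset U V as k (l, 0, 0)) + 4;
          D = 3 * (\<bar>cross U V\<bar> - (l1norm U + l1norm V + 2))
      in B * (l1norm U + 2) < D \<and> B * (l1norm V + 2) < D))"

text \<open>The list of neighbours must start behind the ray in direction \<open>8 + \<i>\<close>, so that it goes round once:
  \<open>8 y - x\<close> is first positive and then negative.  The constants \<open>12 = 2 * 6\<close> and
  \<open>54 = 9 * 6\<close> absorb the rounding errors.\<close>

definition ring_check :: "int \<times> int \<Rightarrow> int \<times> int \<Rightarrow> ((int \<times> int) \<times> int) list \<Rightarrow> label list list \<Rightarrow> nat \<Rightarrow> bool" where
  "ring_check U V as nb k \<longleftrightarrow> (let ls = nb ! k; N = length ls in N > 0 \<and>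
     (\<forall>i\<in>set [0..<N].
        (let Z = aoffset U V as k (ls ! i); W = aoffset U V as k (ls ! (Suc i mod N)) in
          6 * (l1norm Z + l1norm W + 12) < cross Z W \<and> 54 < \<bar>8 * snd Z - fst Z\<bar> \<and>
          (Suc i < N \<longrightarrow> 8 * snd Z - fst Z > 0 \<or> 8 * snd W - fst W < 0))))"

text \<open>After translation, the two memberships say that the neighbour relation is symmetric and
  that consecutive neighbours of \<open>k\<close> are neighbours of each other. The tangencies along
  a corona are thus looked up in the lists and cost no further arithmetic.\<close>

definition graph_check :: "label list list \<Rightarrow> nat \<Rightarrow> bool" where
  "graph_check nb k \<longleftrightarrow> (let ls = nb ! k; N = length ls in
     \<forall>i\<in>set [0..<N]. (case (ls ! i, ls ! (Suc i mod N)) of ((l, m, n), (l', m', n')) \<Rightarrow>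
       l < length nb \<and> \<bar>m\<bar> \<le> 2 \<and> \<bar>n\<bar> \<le> 2 \<and>
       (k, -m, -n) \<in> set (nb ! l) \<and> (l', m' - m, n' - n) \<in> set (nb ! l)))"

text \<open>One of the two orientations of each tangency.\<close>

definition edges :: "label list list \<Rightarrow> (nat \<times> label) list" where
  "edges nb = concat (map (\<lambda>k. map (Pair k)
     (filter (\<lambda>(l, m, n). k < l \<or> k = l \<and> (m > 0 \<or> m = 0 \<and> n > 0)) (nb ! k))) [0..<length nb])"

definition packing_check :: "int \<times> int \<Rightarrow> int \<times> int \<Rightarrow> ((int \<times> int) \<times> int) list \<Rightarrow> label list list \<Rightarrow> bool" where
  "packing_check U V as nb \<longleftrightarrow> length as = length nb \<and> (\<forall>k\<in>set [0..<length nb].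
     sep_check U V as nb k \<and> tail_check U V as k \<and> ring_check U V as nb k \<and> graph_check nb k)"

section \<open>Soundness of the integer checks\<close>

lemma approx_norm:
  assumes "approx z Z"
  shows "1000 * norm z \<le> l1norm Z + 2"
proof -
  have "1000 * \<bar>Re z\<bar> \<le> of_int \<bar>fst Z\<bar> + 1" "1000 * \<bar>Im z\<bar> \<le> of_int \<bar>snd Z\<bar> + 1"
    using assms unfolding approx_def of_int_abs by linarith+
  thus ?thesis using cmod_le[of z] by (simp add: l1norm_def)
qed

text \<open>Applied with \<open>e = 1\<close> to the two lattice vectors and with
  \<open>e = 6\<close> to two offsets.\<close>

lemma cross_error:
  fixes x y x' y' X Y X' Y' e :: real
  assumes "\<bar>x - X\<bar> \<le> e" "\<bar>y - Y\<bar> \<le> e" "\<bar>x' - X'\<bar> \<le> e" "\<bar>y' - Y'\<bar> \<le> e"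
  shows "\<bar>(x * y' - y * x') - (X * Y' - Y * X')\<bar> \<le> e * (\<bar>X\<bar> + \<bar>Y\<bar> + \<bar>X'\<bar> + \<bar>Y'\<bar> + 2 * e)"
proof -
  have e: "0 \<le> e" using assms(1) by linarith
  have prod: "\<bar>a * b - A * B\<bar> \<le> e * (\<bar>A\<bar> + \<bar>B\<bar> + e)" if "\<bar>a - A\<bar> \<le> e" "\<bar>b - B\<bar> \<le> e" for a b A B :: real
  proof -
    have "a * b - A * B = (a - A) * (b - B) + A * (b - B) + (a - A) * B" by (simp add: algebra_simps)
    hence "\<bar>a * b - A * B\<bar> \<le> \<bar>(a - A) * (b - B)\<bar> + \<bar>A * (b - B)\<bar> + \<bar>(a - A) * B\<bar>" by linarith
    also have "\<dots> = \<bar>a - A\<bar> * \<bar>b - B\<bar> + \<bar>A\<bar> * \<bar>b - B\<bar> + \<bar>a - A\<bar> * \<bar>B\<bar>" by (simp only: abs_mult)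
    also have "\<dots> \<le> e * e + \<bar>A\<bar> * e + e * \<bar>B\<bar>"
      using that e by (intro add_mono mult_mono) auto
    finally show ?thesis by (simp add: algebra_simps)
  qed
  have "\<bar>(x * y' - y * x') - (X * Y' - Y * X')\<bar> \<le> \<bar>x * y' - X * Y'\<bar> + \<bar>y * x' - Y * X'\<bar>" by linarith
  also have "\<dots> \<le> e * (\<bar>X\<bar> + \<bar>Y'\<bar> + e) + e * (\<bar>Y\<bar> + \<bar>X'\<bar> + e)"
    by (intro add_mono prod assms)
  finally show ?thesis by (simp add: algebra_simps)
qed

text \<open>Cramer's rule: the cross product with one generator removes that generator from the
  combination, and a cross product is at most the product of the norms.\<close>

lemma lattice_coefficient_bound:
  fixes u v :: complex
  shows "\<bar>of_int m\<bar> * \<bar>Im (cnj u * v)\<bar> \<le> norm (of_int m * u + of_int n * v) * norm v"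
    and "\<bar>of_int n\<bar> * \<bar>Im (cnj u * v)\<bar> \<le> norm (of_int m * u + of_int n * v) * norm u"
proof -
  let ?w = "of_int m * u + of_int n * v"
  have "Im (cnj ?w * v) = of_int m * Im (cnj u * v)" by (simp add: algebra_simps)
  moreover have "\<bar>Im (cnj ?w * v)\<bar> \<le> norm ?w * norm v"
    by (metis abs_Im_le_cmod complex_mod_cnj norm_mult)
  ultimately show "\<bar>of_int m\<bar> * \<bar>Im (cnj u * v)\<bar> \<le> norm ?w * norm v" by (simp only: abs_mult)
  have "Im (cnj u * ?w) = of_int n * Im (cnj u * v)" by (simp add: algebra_simps)
  moreover have "\<bar>Im (cnj u * ?w)\<bar> \<le> norm u * norm ?w"
    by (metis abs_Im_le_cmod complex_mod_cnj norm_mult)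
  ultimately show "\<bar>of_int n\<bar> * \<bar>Im (cnj u * v)\<bar> \<le> norm ?w * norm u"
    by (simp only: abs_mult mult.commute)
qed

text \<open>The scaled radii in \<open>as\<close> need only be upper bounds, because larger radii
  make the separation tests stricter. The equations in \<open>edges\<close> are the one exact
  ingredient.\<close>

locale periodic_data =
  fixes u v :: complex and ds :: "disc list"
    and U V :: "int \<times> int" and as :: "((int \<times> int) \<times> int) list" and nb :: "label list list"
  assumes u: "approx u U" and v: "approx v V"
    and ds: "list_all2 (\<lambda>D A. approx (centre D) (fst A) \<and> 0 < radius D \<and> 1000 * radius D \<le> of_int (snd A)) ds as"
    and check: "packing_check U V as nb"
    and edges: "\<forall>(k, e)\<in>set (edges nb).
      (Re (offset u v ds k e))^2 + (Im (offset u v ds k e))^2 = (radius (ds ! k) + radius (ds ! fst e))^2"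
begin

lemma len: "length as = length ds" "length nb = length ds"
  using ds check by (auto simp: packing_check_def dest: list_all2_lengthD)

lemma base:
  assumes "k < length ds"
  shows "approx (centre (ds ! k)) (fst (as ! k))" "0 < radius (ds ! k)"
    "1000 * radius (ds ! k) \<le> of_int (snd (as ! k))"
  using list_all2_nthD[OF ds assms] by auto

lemma checks:
  assumes "k < length ds"
  shows "sep_check U V as nb k" "tail_check U V as k" "ring_check U V as nb k" "graph_check nb k"
  using check assms len by (auto simp: packing_check_def)

lemma offset_approx:
  assumes "k < length ds" "l < length ds" "\<bar>m\<bar> \<le> 2" "\<bar>n\<bar> \<le> 2"
  shows "\<bar>1000 * Re (offset u v ds k (l, m, n)) - of_int (fst (aoffset U V as k (l, m, n)))\<bar> \<le> 6"
    and "\<bar>1000 * Im (offset u v ds k (l, m, n)) - of_int (snd (aoffset U V as k (l, m, n)))\<bar> \<le> 6"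
proof -
  have *: "\<bar>of_int i * (a - b)\<bar> \<le> 2" if "\<bar>i\<bar> \<le> 2" "\<bar>a - b\<bar> \<le> 1" for i and a b :: real
  proof -
    have "\<bar>of_int i\<bar> * \<bar>a - b\<bar> \<le> 2 * 1" using that by (intro mult_mono) auto
    thus ?thesis by (simp add: abs_mult)
  qed
  have sum: "\<bar>a - b + c + d\<bar> \<le> 6"
    if "\<bar>a\<bar> \<le> 1" "\<bar>b\<bar> \<le> 1" "\<bar>c\<bar> \<le> 2" "\<bar>d\<bar> \<le> 2" for a b c d :: real
    using that by linarith
  have k: "\<bar>1000 * Re (centre (ds ! k)) - of_int (fst (fst (as ! k)))\<bar> \<le> 1"
    "\<bar>1000 * Im (centre (ds ! k)) - of_int (snd (fst (as ! k)))\<bar> \<le> 1"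
    and l: "\<bar>1000 * Re (centre (ds ! l)) - of_int (fst (fst (as ! l)))\<bar> \<le> 1"
    "\<bar>1000 * Im (centre (ds ! l)) - of_int (snd (fst (as ! l)))\<bar> \<le> 1"
    using base assms by (auto simp: approx_def)
  have 1: "\<bar>of_int m * (1000 * Re u - of_int (fst U))\<bar> \<le> 2" "\<bar>of_int n * (1000 * Re v - of_int (fst V))\<bar> \<le> 2"
    "\<bar>of_int m * (1000 * Im u - of_int (snd U))\<bar> \<le> 2" "\<bar>of_int n * (1000 * Im v - of_int (snd V))\<bar> \<le> 2"
    using u v assms by (auto intro!: * simp: approx_def)
  have "1000 * Re (offset u v ds k (l, m, n)) - of_int (fst (aoffset U V as k (l, m, n)))
     = (1000 * Re (centre (ds ! l)) - of_int (fst (fst (as ! l)))) - (1000 * Re (centre (ds ! k)) - of_int (fst (fst (as ! k))))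
       + of_int m * (1000 * Re u - of_int (fst U)) + of_int n * (1000 * Re v - of_int (fst V))"
    by (simp add: offset_def aoffset_def algebra_simps)
  thus "\<bar>1000 * Re (offset u v ds k (l, m, n)) - of_int (fst (aoffset U V as k (l, m, n)))\<bar> \<le> 6"
    using sum[OF l(1) k(1) 1(1,2)] by simp
  have "1000 * Im (offset u v ds k (l, m, n)) - of_int (snd (aoffset U V as k (l, m, n)))
     = (1000 * Im (centre (ds ! l)) - of_int (snd (fst (as ! l)))) - (1000 * Im (centre (ds ! k)) - of_int (snd (fst (as ! k))))
       + of_int m * (1000 * Im u - of_int (snd U)) + of_int n * (1000 * Im v - of_int (snd V))"
    by (simp add: offset_def aoffset_def algebra_simps)
  thus "\<bar>1000 * Im (offset u v ds k (l, m, n)) - of_int (snd (aoffset U V as k (l, m, n)))\<bar> \<le> 6"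
    using sum[OF l(2) k(2) 1(3,4)] by simp
qed

text \<open>If the discs were this close, the lattice vector \<open>w\<close> between them would
  have scaled length at most \<open>B\<close>. Cramer's rule and \<open>tail_check\<close> then
  force both coefficients below 3 in absolute value.\<close>

lemma far_label:
  assumes kl: "k < length ds" "l < length ds"
    and big: "3 \<le> \<bar>m\<bar> \<or> 3 \<le> \<bar>n\<bar>"
  shows "radius (ds ! k) + radius (ds ! l) < norm (offset u v ds k (l, m, n))"
proof (rule ccontr)
  assume "\<not> ?thesis"
  hence le: "norm (offset u v ds k (l, m, n)) \<le> radius (ds ! k) + radius (ds ! l)" by simp
  define w where "w = of_int m * u + of_int n * v"
  define B where "B = snd (as ! k) + snd (as ! l) + l1norm (aoffset U V as k (l, 0, 0)) + 4"
  define D where "D = \<bar>cross U V\<bar> - (l1norm U + l1norm V + 2)"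
  have tc: "B * (l1norm U + 2) < 3 * D" "B * (l1norm V + 2) < 3 * D"
    using checks(2)[OF kl(1)] kl(2) len by (auto simp: tail_check_def B_def D_def Let_def)
  have d: "1000 * norm (centre (ds ! l) - centre (ds ! k)) \<le> l1norm (aoffset U V as k (l, 0, 0)) + 4"
  proof -
    have diff: "1000 * \<bar>a - b\<bar> \<le> \<bar>A - B\<bar> + 2"
      if "\<bar>1000 * a - A\<bar> \<le> 1" "\<bar>1000 * b - B\<bar> \<le> 1" for a b A B :: real
    proof -
      have "\<bar>1000 * a - 1000 * b\<bar> \<le> \<bar>A - B\<bar> + 2" using that by linarith
      moreover have "1000 * \<bar>a - b\<bar> = \<bar>1000 * a - 1000 * b\<bar>"
        using abs_mult[of 1000 "a - b"] by (simp add: right_diff_distrib)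
      ultimately show ?thesis by simp
    qed
    have "1000 * \<bar>Re (centre (ds ! l) - centre (ds ! k))\<bar> \<le> of_int \<bar>fst (fst (as ! l)) - fst (fst (as ! k))\<bar> + 2"
      "1000 * \<bar>Im (centre (ds ! l) - centre (ds ! k))\<bar> \<le> of_int \<bar>snd (fst (as ! l)) - snd (fst (as ! k))\<bar> + 2"
      using base(1)[OF kl(1)] base(1)[OF kl(2)]
      by (simp_all add: approx_def diff)
    thus ?thesis using cmod_le[of "centre (ds ! l) - centre (ds ! k)"]
      by (simp add: l1norm_def aoffset_def)
  qed
  have "norm w \<le> norm (offset u v ds k (l, m, n)) + norm (centre (ds ! l) - centre (ds ! k))"
  proof -
    have "w = offset u v ds k (l, m, n) - (centre (ds ! l) - centre (ds ! k))"
      by (simp add: w_def offset_def)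
    thus ?thesis using norm_triangle_ineq4 by metis
  qed
  hence w: "1000 * norm w \<le> of_int B"
    using le d base(3)[OF kl(1)] base(3)[OF kl(2)] by (simp add: B_def)
  have D: "of_int D \<le> 1000^2 * \<bar>Im (cnj u * v)\<bar>"
  proof -
    have "\<bar>((1000 * Re u) * (1000 * Im v) - (1000 * Im u) * (1000 * Re v)) -
       (of_int (fst U) * of_int (snd V) - of_int (snd U) * of_int (fst V))\<bar> \<le>
       1 * (\<bar>of_int (fst U)\<bar> + \<bar>of_int (snd U)\<bar> + \<bar>of_int (fst V)\<bar> + \<bar>of_int (snd V)\<bar> + 2 * 1)"
      using u v by (intro cross_error) (auto simp: approx_def)
    moreover have "(1000 * Re u) * (1000 * Im v) - (1000 * Im u) * (1000 * Re v) = 1000^2 * Im (cnj u * v)"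
      by simp
    ultimately have "\<bar>1000^2 * Im (cnj u * v) - of_int (cross U V)\<bar> \<le> of_int (l1norm U + l1norm V + 2)"
      by (simp add: cross_def l1norm_def)
    moreover have "1000^2 * \<bar>x\<bar> = \<bar>1000^2 * x\<bar>" for x :: real by (simp add: abs_mult)
    ultimately show ?thesis unfolding D_def of_int_diff of_int_abs by fastforce
  qed
  have B0: "0 \<le> real_of_int B" using w norm_ge_zero[of w] by linarith
  have key: "\<bar>i\<bar> < 3" if "\<bar>of_int i\<bar> * \<bar>Im (cnj u * v)\<bar> \<le> norm w * norm z" "approx z Z"
      "B * (l1norm Z + 2) < 3 * D" for i z Z
  proof (rule ccontr)
    assume "\<not> \<bar>i\<bar> < 3"
    hence "3 \<le> \<bar>real_of_int i\<bar>" by linarith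
    hence "3 * (1000^2 * \<bar>Im (cnj u * v)\<bar>) \<le> \<bar>real_of_int i\<bar> * (1000^2 * \<bar>Im (cnj u * v)\<bar>)"
      by (intro mult_right_mono) auto
    hence "3 * of_int D \<le> \<bar>real_of_int i\<bar> * (1000^2 * \<bar>Im (cnj u * v)\<bar>)"
      using D by linarith
    also have "\<dots> \<le> (1000 * norm w) * (1000 * norm z)" using that(1) by (simp add: power2_eq_square)
    also have "\<dots> \<le> of_int B * of_int (l1norm Z + 2)"
      using w approx_norm[OF that(2)] B0 by (intro mult_mono) auto
    finally have "of_int (3 * D) \<le> real_of_int (B * (l1norm Z + 2))" by simp
    thus False using that(3) by linarith
  qed
  have "\<bar>m\<bar> < 3" by (rule key[OF _ v tc(2)]) (unfold w_def, rule lattice_coefficient_bound)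
  moreover have "\<bar>n\<bar> < 3" by (rule key[OF _ u tc(1)]) (unfold w_def, rule lattice_coefficient_bound)
  ultimately show False using big by linarith
qed

lemma graph:
  assumes "k < length ds" "i < length (nb ! k)" "nb ! k ! i = (l, m, n)"
  shows "l < length ds" "\<bar>m\<bar> \<le> 2" "\<bar>n\<bar> \<le> 2" "(k, -m, -n) \<in> set (nb ! l)"
    "nb ! k ! (Suc i mod length (nb ! k)) = (l', m', n') \<Longrightarrow> (l', m' - m, n' - n) \<in> set (nb ! l)"
  using checks(4)[OF assms(1)] assms len by (auto simp: graph_check_def Let_def dest!: bspec[of _ _ i])

text \<open>The last alternative is strict, so a label outside the list belongs to a disc that
  neither overlaps nor touches disc \<open>k\<close>. This gives both disjointness and the
  completeness of the neighbour lists.\<close>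

lemma near_or_far:
  assumes "k < length ds" "l < length ds"
  shows "(l, m, n) \<in> set (nb ! k) \<or> (l, m, n) = (k, 0, 0) \<or>
    radius (ds ! k) + radius (ds ! l) < norm (offset u v ds k (l, m, n))"
proof (cases "3 \<le> \<bar>m\<bar> \<or> 3 \<le> \<bar>n\<bar>")
  case True
  thus ?thesis using far_label assms by blast
next
  case False
  hence mn: "m \<in> set [-2..2]" "n \<in> set [-2..2]" "\<bar>m\<bar> \<le> 2" "\<bar>n\<bar> \<le> 2" by auto
  define w where "w = offset u v ds k (l, m, n)"
  define Z where "Z = aoffset U V as k (l, m, n)"
  define S where "S = snd (as ! k) + snd (as ! l)"
  have "l \<in> set [0..<length as]" using assms len by simp
  hence c: "(S + 12)^2 < (fst Z)^2 + (snd Z)^2 \<or> (l, m, n) \<in> set (nb ! k) \<or> (l, m, n) = (k, 0, 0)"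
    using checks(1)[OF assms(1)] mn unfolding sep_check_def Let_def Z_def S_def by blast
  have "radius (ds ! k) + radius (ds ! l) < norm w" if s: "(S + 12)^2 < (fst Z)^2 + (snd Z)^2"
  proof -
    have S0: "0 \<le> real_of_int S" "1000 * (radius (ds ! k) + radius (ds ! l)) \<le> real_of_int S"
      using base[OF assms(1)] base[OF assms(2)] by (simp_all add: S_def)
    define z where "z = Complex (of_int (fst Z)) (of_int (snd Z))"
    have "(real_of_int S + 12)^2 < (of_int (fst Z))^2 + (of_int (snd Z))^2"
      using s by (metis (mono_tags) of_int_add of_int_less_iff of_int_numeral of_int_power)
    hence "(real_of_int S + 12)^2 < (norm z)^2" by (simp add: z_def cmod_power2)
    hence z: "real_of_int S + 12 < norm z" using power2_less_imp_less by fastforce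
    have "norm (z - 1000 * w) \<le> \<bar>Re (z - 1000 * w)\<bar> + \<bar>Im (z - 1000 * w)\<bar>" by (rule cmod_le)
    also have "\<dots> \<le> 12"
      using offset_approx[OF assms mn(3,4)] by (simp add: z_def w_def Z_def)
    finally have "norm z \<le> 12 + 1000 * norm w"
      using norm_triangle_ineq2[of z "1000 * w"] by (simp add: norm_mult)
    hence "1000 * (radius (ds ! k) + radius (ds ! l)) < 1000 * norm w" using z S0 by linarith
    thus ?thesis by simp
  qed
  thus ?thesis using c by (auto simp: w_def)
qed

lemma offset_flip: "offset u v ds l (k, -m, -n) = - offset u v ds k (l, m, n)"
  by (simp add: offset_def algebra_simps)

lemma touching_half:
  assumes "k < length ds" "(l, m, n) \<in> set (nb ! k)" "k < l \<or> k = l \<and> (m > 0 \<or> m = 0 \<and> n > 0)"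
  shows "norm (offset u v ds k (l, m, n)) = radius (ds ! k) + radius (ds ! l)"
proof (rule power2_eq_imp_eq)
  have "(k, l, m, n) \<in> Pair k ` set (filter (\<lambda>(l, m, n). k < l \<or> k = l \<and> (m > 0 \<or> m = 0 \<and> n > 0)) (nb ! k))"
    using assms by simp
  hence "(k, l, m, n) \<in> set (edges nb)"
    unfolding edges_def using assms(1) len by auto
  from bspec[OF edges this] show "(norm (offset u v ds k (l, m, n)))^2 = (radius (ds ! k) + radius (ds ! l))^2"
    by (simp only: cmod_power2 prod.case fst_conv)
  obtain i where "i < length (nb ! k)" "nb ! k ! i = (l, m, n)"
    using assms(2) by (auto simp: in_set_conv_nth)
  hence "l < length ds" by (rule graph[OF assms(1)])
  thus "0 \<le> radius (ds ! k) + radius (ds ! l)"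
    using base(2)[OF assms(1)] base(2)[of l] by simp
qed simp

text \<open>The zero offset lies on the ray in direction \<open>8 + \<i>\<close> and so fails the
  test with constant 54 in \<open>ring_check\<close>.\<close>

lemma self_not_neighbour:
  assumes "k < length ds"
  shows "(k, 0, 0) \<notin> set (nb ! k)"
proof
  assume "(k, 0, 0) \<in> set (nb ! k)"
  then obtain i where i: "i < length (nb ! k)" "nb ! k ! i = (k, 0, 0)" by (auto simp: in_set_conv_nth)
  have "aoffset U V as k (k, 0, 0) = (0, 0)" by (simp add: aoffset_def)
  thus False using checks(3)[OF assms] i
    by (auto simp: ring_check_def Let_def dest!: bspec[of _ _ i])
qed

text \<open>\<open>edges\<close> covers one orientation of each contact. For the other, the symmetry
  in \<open>graph_check\<close> supplies the reversed label, whose offset is the negative.\<close>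

lemma touching:
  assumes k: "k < length ds" and mem: "(l, m, n) \<in> set (nb ! k)"
  shows "norm (offset u v ds k (l, m, n)) = radius (ds ! k) + radius (ds ! l)"
proof (cases "k < l \<or> k = l \<and> (m > 0 \<or> m = 0 \<and> n > 0)")
  case True
  thus ?thesis by (rule touching_half[OF assms])
next
  case False
  obtain i where i: "i < length (nb ! k)" "nb ! k ! i = (l, m, n)"
    using mem by (auto simp: in_set_conv_nth)
  have "(l, m, n) \<noteq> (k, 0, 0)" using self_not_neighbour[OF k] mem by metis
  hence "l < k \<or> l = k \<and> (- m > 0 \<or> - m = 0 \<and> - n > 0)" using False by auto
  from touching_half[OF graph(1)[OF k i] graph(4)[OF k i] this]
  show ?thesis by (simp add: offset_flip del: of_int_minus)
qed

lemma site_diff: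
  "centre (site u v ds (l, m', n')) - centre (site u v ds (k, m, n)) = offset u v ds k (l, m' - m, n' - n)"
  by (simp add: site_def offset_def algebra_simps)

lemma radius_site [simp]: "radius (site u v ds (k, m, n)) = radius (ds ! k)"
  by (simp add: site_def)

lemma dist_site:
  "dist (centre (site u v ds (k, m, n))) (centre (site u v ds (l, m', n')))
    = norm (offset u v ds k (l, m' - m, n' - n))"
  by (metis dist_commute dist_norm site_diff)

lemma tangent_site_iff:
  assumes "k < length ds" "l < length ds"
  shows "tangent (site u v ds (k, m, n)) (site u v ds (l, m', n')) \<longleftrightarrow> (l, m' - m, n' - n) \<in> set (nb ! k)"
proof
  assume "tangent (site u v ds (k, m, n)) (site u v ds (l, m', n'))"
  hence t: "norm (offset u v ds k (l, m' - m, n' - n)) = radius (ds ! k) + radius (ds ! l)"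
    by (simp add: tangent_def dist_site)
  moreover have "offset u v ds k (k, 0, 0) = 0" by (simp add: offset_def)
  ultimately show "(l, m' - m, n' - n) \<in> set (nb ! k)"
    using near_or_far[OF assms, of "m' - m" "n' - n"] base(2)[OF assms(1)] base(2)[OF assms(2)]
    by auto
next
  assume "(l, m' - m, n' - n) \<in> set (nb ! k)"
  thus "tangent (site u v ds (k, m, n)) (site u v ds (l, m', n'))"
    using touching[OF assms(1)] by (simp add: tangent_def dist_site)
qed

lemma packing: "packing (periodic u v ds)"
  unfolding packing_def
proof (intro conjI ballI pairwiseI)
  fix D assume "D \<in> periodic u v ds"
  thus "0 < radius D" by (auto simp: periodic_def base)
next
  fix D E assume "D \<in> periodic u v ds" "E \<in> periodic u v ds" "D \<noteq> E"
  then obtain k m n l m' n' where D: "D = site u v ds (k, m, n)" "k < length ds"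
    and E: "E = site u v ds (l, m', n')" "l < length ds"
    by (auto simp: periodic_def)
  have "radius D + radius E \<le> dist (centre D) (centre E)"
    using near_or_far[OF D(2) E(2), of "m' - m" "n' - n"] touching[OF D(2), of l "m' - m" "n' - n"] \<open>D \<noteq> E\<close>
    by (auto simp: D E dist_site)
  thus "interior (region D) \<inter> interior (region E) = {}"
    unfolding region_def interior_cball by (rule disjoint_ballI)
qed

lemma surrounded:
  assumes "D \<in> periodic u v ds"
  shows "surrounded (periodic u v ds) D"
proof -
  obtain k a b where D: "D = site u v ds (k, a, b)" and k: "k < length ds"
    using assms by (auto simp: periodic_def)
  define N where "N = length (nb ! k)"
  define ws where "ws = map (offset u v ds k) (nb ! k)"
  \<comment> \<open>\<open>D\<close> is the translate of base disc \<open>k\<close> by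
    \<open>a\<close> and \<open>b\<close>, so its corona is the translated corona of the base
    disc.\<close>
  define shift where "shift = (\<lambda>(l, m, n). (l :: nat, a + m, b + n))"
  define Ds where "Ds = map (\<lambda>e. site u v ds (shift e)) (nb ! k)"
  have N: "length ws = N" "length Ds = N" "N > 0"
    using checks(3)[OF k] by (auto simp: ws_def Ds_def N_def ring_check_def Let_def)
  have off: "ws ! i = offset u v ds k (nb ! k ! i)" if "i < N" for i
    using that by (simp add: ws_def N_def)
  have Dsi: "Ds ! i = site u v ds (shift (nb ! k ! i))" if "i < N" for i
    using that by (simp add: Ds_def N_def)
  define Z where "Z i = aoffset U V as k (nb ! k ! i)" for i
  have nxt: "Suc i mod N < N" for i using N(3) by simp
  have Z: "\<bar>1000 * Re (ws ! i) - of_int (fst (Z i))\<bar> \<le> 6" "\<bar>1000 * Im (ws ! i) - of_int (snd (Z i))\<bar> \<le> 6"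
    if "i < N" for i
  proof -
    obtain l m n where e: "nb ! k ! i = (l, m, n)" by (cases "nb ! k ! i")
    show "\<bar>1000 * Re (ws ! i) - of_int (fst (Z i))\<bar> \<le> 6" "\<bar>1000 * Im (ws ! i) - of_int (snd (Z i))\<bar> \<le> 6"
      using graph[OF k _ e] that offset_approx[OF k] by (simp_all add: off Z_def e N_def)
  qed
  have ring: "6 * (l1norm (Z i) + l1norm (Z (Suc i mod N)) + 12) < cross (Z i) (Z (Suc i mod N))"
    "54 < \<bar>8 * snd (Z i) - fst (Z i)\<bar>"
    "Suc i < N \<Longrightarrow> 8 * snd (Z i) - fst (Z i) > 0 \<or> 8 * snd (Z (Suc i)) - fst (Z (Suc i)) < 0" if "i < N" for i
    using checks(3)[OF k] that by (auto simp: ring_check_def Let_def Z_def N_def dest!: bspec[of _ _ i])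
  \<comment> \<open>\<open>Complex 8 (-1)\<close> is conjugate to the direction of the cut, and
    multiplying by it gives the imaginary part \<open>8 y - x\<close>. The positive real axis would
    not serve as cut, since some neighbours lie exactly on it.\<close>
  have side: "Im (ws ! i * Complex 8 (-1)) \<noteq> 0"
    "Im (ws ! i * Complex 8 (-1)) > 0 \<longleftrightarrow> 8 * snd (Z i) - fst (Z i) > 0" if "i < N" for i
  proof -
    have "\<bar>1000 * Im (ws ! i * Complex 8 (-1)) - of_int (8 * snd (Z i) - fst (Z i))\<bar> \<le> 54"
      using Z[OF that] by (simp add: abs_le_iff)
    moreover have "54 < \<bar>real_of_int (8 * snd (Z i) - fst (Z i))\<bar>"
      using ring(2)[OF that] by linarith
    ultimately show "Im (ws ! i * Complex 8 (-1)) \<noteq> 0"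
      "Im (ws ! i * Complex 8 (-1)) > 0 \<longleftrightarrow> 8 * snd (Z i) - fst (Z i) > 0"
      by linarith+
  qed
  have ccw: "Im (cnj (ws ! i) * ws ! (Suc i mod N)) > 0" if "i < N" for i
  proof -
    let ?j = "Suc i mod N"
    have "\<bar>((1000 * Re (ws ! i)) * (1000 * Im (ws ! ?j)) - (1000 * Im (ws ! i)) * (1000 * Re (ws ! ?j))) -
       (of_int (fst (Z i)) * of_int (snd (Z ?j)) - of_int (snd (Z i)) * of_int (fst (Z ?j)))\<bar> \<le>
       6 * (\<bar>of_int (fst (Z i))\<bar> + \<bar>of_int (snd (Z i))\<bar> + \<bar>of_int (fst (Z ?j))\<bar> + \<bar>of_int (snd (Z ?j))\<bar> + 2 * 6)"
      using Z[OF that] Z[OF nxt] by (intro cross_error)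
    moreover have "(1000 * Re (ws ! i)) * (1000 * Im (ws ! ?j)) - (1000 * Im (ws ! i)) * (1000 * Re (ws ! ?j))
       = 1000^2 * Im (cnj (ws ! i) * ws ! ?j)" by simp
    ultimately have "\<bar>1000^2 * Im (cnj (ws ! i) * ws ! ?j) - of_int (cross (Z i) (Z ?j))\<bar>
       \<le> of_int (6 * (l1norm (Z i) + l1norm (Z ?j) + 12))"
      by (simp add: cross_def l1norm_def)
    moreover have "of_int (6 * (l1norm (Z i) + l1norm (Z ?j) + 12)) < real_of_int (cross (Z i) (Z ?j))"
      using ring(1)[OF that] by (simp only: of_int_less_iff)
    ultimately have "0 < 1000^2 * Im (cnj (ws ! i) * ws ! ?j)" by linarith
    thus ?thesis by (rule zero_less_mult_pos) simp
  qed
  obtain \<theta> where \<theta>: "\<And>i. i < N \<Longrightarrow> ws ! i = rcis (norm (ws ! i)) (\<theta> i)"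
    "\<And>i j. j < N \<Longrightarrow> i < j \<Longrightarrow> \<theta> i < \<theta> j \<and> \<theta> j < \<theta> i + 2 * pi"
    "(\<Sum>i<N. arccos (ws ! i \<bullet> ws ! (Suc i mod N) / (norm (ws ! i) * norm (ws ! (Suc i mod N))))) = 2 * pi"
  proof (rule ring_angles[of ws "Complex 8 (-1)", unfolded N(1)])
    fix i assume i: "Suc i < N"
    thus "Im (ws ! i * Complex 8 (-1)) > 0 \<or> Im (ws ! Suc i * Complex 8 (-1)) < 0"
      using ring(3)[of i] side[of i] side[of "Suc i"] by (metis Suc_lessD linorder_neqE_linordered_idom order_less_asym)
  qed (use N side ccw in auto)
  have diff: "centre (Ds ! i) - centre D = ws ! i" if "i < N" for i
  proof -
    obtain l m n where e: "nb ! k ! i = (l, m, n)" by (cases "nb ! k ! i")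
    show ?thesis using site_diff[of l "a + m" "b + n" k a b] that by (simp add: Dsi off e D shift_def)
  qed
  show ?thesis unfolding surrounded_def
  proof (intro exI[of _ Ds] conjI)
    \<comment> \<open>Equal discs would have polar angles differing by a multiple of 2 pi, but the
      difference lies strictly between 0 and 2 pi.\<close>
    have neq: "Ds ! i \<noteq> Ds ! j" if "i < j" "j < N" for i j
    proof
      assume "Ds ! i = Ds ! j"
      hence eq: "ws ! i = ws ! j" using diff that by (metis order_less_trans)
      have w0: "ws ! i \<noteq> 0" using side(1)[of i] that by auto
      have i: "i < N" using that by simp
      have "cis (\<theta> j - \<theta> i) = 1"
      proof -
        have "rcis (norm (ws ! i)) (\<theta> i) = rcis (norm (ws ! i)) (\<theta> j)"
          using \<theta>(1)[OF i] \<theta>(1)[OF that(2)] eq by metis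
        hence "cis (\<theta> i) = cis (\<theta> j)" using w0 by (simp add: rcis_def)
        thus ?thesis by (simp add: cis_divide[symmetric])
      qed
      hence "cos (\<theta> j - \<theta> i) = 1" by (metis cis.sel(1) one_complex.sel(1))
      then obtain x :: int where "\<theta> j - \<theta> i = of_int x * 2 * pi" using cos_one_2pi_int by blast
      moreover have "0 < \<theta> j - \<theta> i" "\<theta> j - \<theta> i < 2 * pi" using \<theta>(2)[OF that(2,1)] by auto
      ultimately have "0 < x" "of_int x * (2 * pi) < 1 * (2 * pi)" by (auto simp: zero_less_mult_iff)
      hence "0 < x" "real_of_int x < 1"
        using mult_less_cancel_right_pos[of "2 * pi" "real_of_int x" 1] pi_gt_zero by auto
      thus False by linarith
    qed
    thus "distinct Ds" unfolding distinct_conv_nth N(2) by (metis linorder_neqE_nat)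
    show "set Ds = {E \<in> periodic u v ds. tangent D E}"
    proof (intro equalityI subsetI)
      fix E assume "E \<in> set Ds"
      then obtain i where i: "i < N" "E = Ds ! i" by (metis N(2) in_set_conv_nth)
      obtain l m n where e: "nb ! k ! i = (l, m, n)" by (cases "nb ! k ! i")
      have l: "l < length ds" using graph(1)[OF k _ e] i by (simp add: N_def)
      have E: "E = site u v ds (l, a + m, b + n)" using i by (simp add: Dsi e shift_def)
      have "(l, m, n) \<in> set (nb ! k)" using i e by (metis N_def nth_mem)
      hence "tangent D E" using tangent_site_iff[OF k l, of a b "a + m" "b + n"] by (simp add: D E)
      thus "E \<in> {E \<in> periodic u v ds. tangent D E}" using l by (auto simp: E periodic_def)
    next
      fix E assume "E \<in> {E \<in> periodic u v ds. tangent D E}"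
      then obtain l m n where E: "E = site u v ds (l, m, n)" "l < length ds" "tangent D E"
        by (auto simp: periodic_def)
      hence "(l, m - a, n - b) \<in> set (nb ! k)" using tangent_site_iff[OF k] by (simp add: D)
      hence "site u v ds (shift (l, m - a, n - b)) \<in> set Ds" unfolding Ds_def by simp
      thus "E \<in> set Ds" by (simp add: shift_def E)
    qed
    have p: "centre (Ds ! i) = centre D + rcis (dist (centre D) (centre (Ds ! i))) (\<theta> i)" if "i < N" for i
      using \<theta>(1)[OF that] diff[OF that] by (metis add.commute diff_add_cancel dist_commute dist_norm)
    show "cyclically_ordered (centre D) (map centre Ds)"
      unfolding cyclically_ordered_def
      by (intro exI[of _ \<theta>] conjI allI impI) (use N p \<theta>(2) in auto)
    show "\<forall>i<length Ds. tangent (Ds ! i) (Ds ! (Suc i mod length Ds))"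
    proof (intro allI impI)
      fix i assume "i < length Ds"
      hence i: "i < N" by (simp add: N)
      obtain l m n where e: "nb ! k ! i = (l, m, n)" by (cases "nb ! k ! i")
      obtain l' m' n' where e': "nb ! k ! (Suc i mod N) = (l', m', n')" by (cases "nb ! k ! (Suc i mod N)")
      have l: "l < length ds" "l' < length ds"
        using graph(1)[OF k _ e] graph(1)[OF k _ e'] i nxt by (auto simp: N_def)
      have "(l', m' - m, n' - n) \<in> set (nb ! l)"
        using graph(5)[OF k _ e] e' i by (simp add: N_def)
      thus "tangent (Ds ! i) (Ds ! (Suc i mod length Ds))"
        using tangent_site_iff[OF l] i nxt by (simp add: N Dsi e e' shift_def)
    qed
    have "(\<Sum>i<N. angle_at (centre D) (centre (Ds ! i)) (centre (Ds ! (Suc i mod N)))) = 2 * pi"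
      using \<theta>(3) nxt by (simp add: angle_at_def diff)
    thus "(\<Sum>i<length Ds. angle_at (centre D) (centre (Ds ! i)) (centre (Ds ! (Suc i mod length Ds)))) = 2 * pi"
      by (simp add: N)
  qed
qed

theorem compact: "compact_packing_using s t (periodic u v ds)" if "radius ` set ds = {s, t}"
proof -
  have "radius ` periodic u v ds = radius ` set ds"
    by (force simp: periodic_def image_image set_conv_nth)
  thus ?thesis using that packing surrounded
    by (simp add: compact_packing_using_def compact_packing_def)
qed

end

section \<open>The nine packings\<close>

text \<open>The auxiliary variables are lengths in the packing: \<open>t = sqrt (1 + 2 r)\<close> (called \<open>a\<close> for \<open>c7\<close>) and
  \<open>q = sqrt (r^2 + 2 r)\<close> are the heights of the triangles formed by one large and two small, respectively
  by one small and two large centres; \<open>j = 1 / sqrt 3\<close>, \<open>p = r / sqrt 3\<close> and \<open>b = r sqrt 3\<close>.  For \<open>c2\<close>,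
  three mutually tangent small discs lie in a hexagon of large ones whose centres are alternately
  at distance \<open>2 a\<close> and \<open>2 b\<close> from its centre, \<open>s = a sqrt 3\<close> and \<open>c = b sqrt 3\<close>.  Adjoining these roots as
  variables makes every tangency a polynomial identity modulo the relations.\<close>

lemma packing_c1:
  fixes r t q :: real
  assumes rel: "t^2 = 1 + 2 * r" "q^2 = r^2 + 2 * r" "r^2 + 2 * r - 1 + r * q = t"
    and bounds: "6375/10000 \<le> r" "r \<le> 6376/10000"
      "15083/10000 \<le> t" "t \<le> 15084/10000"
      "12967/10000 \<le> q" "q \<le> 12968/10000"
  shows "\<exists>P. compact_packing_using 1 r P"
proof -
  let ?u = "Complex (2 * r + 2 * q) 0" and ?v = "Complex (r + q) (1 + t)"
  let ?ds = "[(Complex 0 t, 1),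
      (Complex 0 (-t), 1),
      (Complex r 0, r),
      (Complex (- r) 0, r)]"
  let ?U = "(3869, 0) :: int \<times> int" and ?V = "(1934, 2508) :: int \<times> int"
  let ?as = "[((0, 1508), 1000), ((0, -1508), 1000), ((638, 0), 638), ((-638, 0), 638)] :: ((int \<times> int) \<times> int) list"
  let ?nb = "[[(3, 0, 1), (1, -1, 2), (2, -1, 1), (1, -1, 1), (3, 0, 0), (2, 0, 0), (1, 0, 1)],
      [(0, 1, -1), (2, 0, 0), (3, 0, 0), (0, 0, -1), (2, 0, -1), (0, 1, -2), (3, 1, -1)],
      [(1, 0, 1), (0, 0, 0), (3, 0, 0), (1, 0, 0), (0, 1, -1)],
      [(0, 0, 0), (1, -1, 1), (0, 0, -1), (1, 0, 0), (2, 0, 0)]] :: label list list"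
  interpret periodic_data ?u ?v ?ds ?U ?V ?as ?nb
  proof
    show "approx ?u ?U" "approx ?v ?V"
      using bounds by (simp_all add: approx_def abs_le_iff)
    show "list_all2 (\<lambda>D A. approx (centre D) (fst A) \<and> 0 < radius D \<and> 1000 * radius D \<le> of_int (snd A)) ?ds ?as"
      using bounds by (simp add: approx_def abs_le_iff)
    show "packing_check ?U ?V ?as ?nb" by code_simp
    show "\<forall>(k, e)\<in>set (edges ?nb).
      (Re (offset ?u ?v ?ds k e))^2 + (Im (offset ?u ?v ?ds k e))^2 = (radius (?ds ! k) + radius (?ds ! fst e))^2"
      by (simp add: edges_def offset_def upt_rec; (intro conjI)?;
          (fact rel | use rel in algebra | simp add: power2_eq_square algebra_simps))
  qed
  have "radius ` set ?ds = {1, r}" by auto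
  thus ?thesis using compact by blast
qed

text \<open>\<open>a^2 - a * b + b^2 = 1\<close> is the law of cosines at 60 degrees for adjacent
  large discs of the hexagon. The last two relations are the contacts of small discs with the large
  ones at distance \<open>2 * a\<close> and \<open>2 * b\<close>. The relations on products such as
  \<open>s * c\<close> are needed because the squares determine these products only up to
  sign.\<close>

lemma packing_c2:
  fixes r p a b s c :: real
  assumes rel: "s^2 = 3 * a^2" "c^2 = 3 * b^2" "s * c = 3 * a * b" "a^2 - a * b + b^2 = 1" "r^2 = 3 * p^2" "r * s = 3 * p * a" "r * c = 3 * p * b" "(2 * a - p)^2 + r^2 = (1 + r)^2" "2 * b = 2 * p + 1 + r"
    and bounds: "5451/10000 \<le> r" "r \<le> 5452/10000"
      "3147/10000 \<le> p" "p \<le> 3148/10000"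
      "8802/10000 \<le> a" "a \<le> 8803/10000"
      "10873/10000 \<le> b" "b \<le> 10874/10000"
      "15246/10000 \<le> s" "s \<le> 15247/10000"
      "18832/10000 \<le> c" "c \<le> 18833/10000"
  shows "\<exists>P. compact_packing_using 1 r P"
proof -
  let ?u = "Complex (2 * a + 2 * b) 0" and ?v = "Complex (a + b) (s + c)"
  let ?ds = "[(Complex (2 * a) 0, 1),
      (Complex (- a) s, 1),
      (Complex (- a) (-s), 1),
      (Complex (-2 * p) 0, r),
      (Complex p (-r), r),
      (Complex p r, r)]"
  let ?U = "(3935, 0) :: int \<times> int" and ?V = "(1968, 3408) :: int \<times> int"
  let ?as = "[((1761, 0), 1000), ((-880, 1525), 1000), ((-880, -1525), 1000), ((-629, 0), 546), ((315, -545), 546), ((315, 545), 546)] :: ((int \<times> int) \<times> int) list"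
  let ?nb = "[[(1, 1, 0), (2, 0, 1), (5, 0, 0), (4, 0, 0), (1, 1, -1), (2, 1, 0), (3, 1, 0)],
      [(2, 0, 1), (0, -1, 1), (4, -1, 1), (2, -1, 1), (0, -1, 0), (3, 0, 0), (5, 0, 0)],
      [(4, 0, 0), (3, 0, 0), (0, -1, 0), (1, 0, -1), (5, 0, -1), (0, 0, -1), (1, 1, -1)],
      [(5, 0, 0), (1, 0, 0), (0, -1, 0), (2, 0, 0), (4, 0, 0)],
      [(0, 0, 0), (5, 0, 0), (3, 0, 0), (2, 0, 0), (1, 1, -1)],
      [(2, 0, 1), (1, 0, 0), (3, 0, 0), (4, 0, 0), (0, 0, 0)]] :: label list list"
  interpret periodic_data ?u ?v ?ds ?U ?V ?as ?nb
  proof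
    show "approx ?u ?U" "approx ?v ?V"
      using bounds by (simp_all add: approx_def abs_le_iff)
    show "list_all2 (\<lambda>D A. approx (centre D) (fst A) \<and> 0 < radius D \<and> 1000 * radius D \<le> of_int (snd A)) ?ds ?as"
      using bounds by (simp add: approx_def abs_le_iff)
    show "packing_check ?U ?V ?as ?nb" by code_simp
    show "\<forall>(k, e)\<in>set (edges ?nb).
      (Re (offset ?u ?v ?ds k e))^2 + (Im (offset ?u ?v ?ds k e))^2 = (radius (?ds ! k) + radius (?ds ! fst e))^2"
      by (simp add: edges_def offset_def upt_rec; (intro conjI)?;
          (fact rel | use rel in algebra | simp add: power2_eq_square algebra_simps))
  qed
  have "radius ` set ?ds = {1, r}" by auto
  thus ?thesis using compact by blast
qed

text \<open>Large discs form rows in direction \<open>?u\<close>. The second relation says that the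
  small discs at \<open>(1, q)\<close> and \<open>(0, 1 + r)\<close>, resting in a gap and on top of
  a large disc, touch.\<close>

lemma packing_c3:
  fixes r q :: real
  assumes rel: "q^2 = r^2 + 2 * r" "1 + 2 * r - r^2 = (1 + r) * q"
    and bounds: "5332/10000 \<le> r" "r \<le> 5333/10000"
      "11623/10000 \<le> q" "q \<le> 11624/10000"
  shows "\<exists>P. compact_packing_using 1 r P"
proof -
  let ?u = "Complex 2 0" and ?v = "Complex 1 (1 + r + q)"
  let ?ds = "[(Complex 0 0, 1),
      (Complex 1 q, r),
      (Complex 0 (1 + r), r)]"
  let ?U = "(2000, 0) :: int \<times> int" and ?V = "(1000, 2696) :: int \<times> int"
  let ?as = "[((0, 0), 1000), ((1000, 1162), 534), ((0, 1533), 534)] :: ((int \<times> int) \<times> int) list"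
  let ?nb = "[[(1, 0, 0), (2, 0, 0), (1, -1, 0), (0, -1, 0), (2, 0, -1), (1, 0, -1), (2, 1, -1), (0, 1, 0)],
      [(2, 1, 0), (0, 0, 1), (2, 0, 0), (0, 0, 0), (0, 1, 0)],
      [(0, 0, 1), (0, -1, 1), (1, -1, 0), (0, 0, 0), (1, 0, 0)]] :: label list list"
  interpret periodic_data ?u ?v ?ds ?U ?V ?as ?nb
  proof
    show "approx ?u ?U" "approx ?v ?V"
      using bounds by (simp_all add: approx_def abs_le_iff)
    show "list_all2 (\<lambda>D A. approx (centre D) (fst A) \<and> 0 < radius D \<and> 1000 * radius D \<le> of_int (snd A)) ?ds ?as"
      using bounds by (simp add: approx_def abs_le_iff)
    show "packing_check ?U ?V ?as ?nb" by code_simp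
    show "\<forall>(k, e)\<in>set (edges ?nb).
      (Re (offset ?u ?v ?ds k e))^2 + (Im (offset ?u ?v ?ds k e))^2 = (radius (?ds ! k) + radius (?ds ! fst e))^2"
      by (simp add: edges_def offset_def upt_rec; (intro conjI)?;
          (fact rel | use rel in algebra | simp add: power2_eq_square algebra_simps))
  qed
  have "radius ` set ?ds = {1, r}" by auto
  thus ?thesis using compact by blast
qed

text \<open>Square lattice of large discs with a small disc in each hole; \<open>rel\<close> equates
  the two expressions for half the diagonal.\<close>

lemma packing_c4:
  fixes r :: real
  assumes rel: "(1 + r)^2 = 2"
    and bounds: "4142/10000 \<le> r" "r \<le> 4143/10000"
  shows "\<exists>P. compact_packing_using 1 r P"
proof -
  let ?u = "Complex 2 0" and ?v = "Complex 0 2"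
  let ?ds = "[(Complex 0 0, 1),
      (Complex 1 1, r)]"
  let ?U = "(2000, 0) :: int \<times> int" and ?V = "(0, 2000) :: int \<times> int"
  let ?as = "[((0, 0), 1000), ((1000, 1000), 415)] :: ((int \<times> int) \<times> int) list"
  let ?nb = "[[(1, 0, 0), (0, 0, 1), (1, -1, 0), (0, -1, 0), (1, -1, -1), (0, 0, -1), (1, 0, -1), (0, 1, 0)],
      [(0, 1, 1), (0, 0, 1), (0, 0, 0), (0, 1, 0)]] :: label list list"
  interpret periodic_data ?u ?v ?ds ?U ?V ?as ?nb
  proof
    show "approx ?u ?U" "approx ?v ?V"
      using bounds by (simp_all add: approx_def abs_le_iff)
    show "list_all2 (\<lambda>D A. approx (centre D) (fst A) \<and> 0 < radius D \<and> 1000 * radius D \<le> of_int (snd A)) ?ds ?as"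
      using bounds by (simp add: approx_def abs_le_iff)
    show "packing_check ?U ?V ?as ?nb" by code_simp
    show "\<forall>(k, e)\<in>set (edges ?nb).
      (Re (offset ?u ?v ?ds k e))^2 + (Im (offset ?u ?v ?ds k e))^2 = (radius (?ds ! k) + radius (?ds ! fst e))^2"
      by (simp add: edges_def offset_def upt_rec; (intro conjI)?;
          (fact rel | use rel in algebra | simp add: power2_eq_square algebra_simps))
  qed
  have "radius ` set ?ds = {1, r}" by auto
  thus ?thesis using compact by blast
qed

text \<open>A small disc at the origin is surrounded by six small ones. The last relation is the
  contact between the large disc at \<open>(2, 0)\<close> and the small one at
  \<open>(3 * p, r)\<close>.\<close>

lemma packing_c5:
  fixes r j p :: real
  assumes rel: "3 * j^2 = 1" "p = j * r" "3 * r^2 - 12 * p - 2 * r + 3 = 0"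
    and bounds: "3861/10000 \<le> r" "r \<le> 3862/10000"
      "5773/10000 \<le> j" "j \<le> 5774/10000"
      "2229/10000 \<le> p" "p \<le> 2230/10000"
  shows "\<exists>P. compact_packing_using 1 r P"
proof -
  let ?u = "Complex 3 (3 * j)" and ?v = "Complex 0 (6 * j)"
  let ?ds = "[(Complex 2 0, 1),
      (Complex (- 2) 0, 1),
      (Complex 0 0, r),
      (Complex (3 * p) r, r),
      (Complex 0 (2 * r), r),
      (Complex (-3 * p) r, r),
      (Complex (-3 * p) (-r), r),
      (Complex 0 (-2 * r), r),
      (Complex (3 * p) (-r), r)]"
  let ?U = "(3000, 1732) :: int \<times> int" and ?V = "(0, 3464) :: int \<times> int"
  let ?as = "[((2000, 0), 1000), ((-2000, 0), 1000), ((0, 0), 387), ((669, 386), 387), ((0, 772), 387), ((-669, 386), 387), ((-669, -386), 387), ((0, -772), 387), ((669, -386), 387)] :: ((int \<times> int) \<times> int) list"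
  let ?nb = "[[(7, 1, 0), (6, 1, 0), (1, 1, 0), (3, 0, 0), (8, 0, 0), (1, 1, -1), (5, 1, -1), (4, 1, -1), (1, 2, -1)],
      [(5, 0, 0), (0, -1, 1), (8, -1, 1), (7, -1, 1), (0, -2, 1), (4, -1, 0), (3, -1, 0), (0, -1, 0), (6, 0, 0)],
      [(3, 0, 0), (4, 0, 0), (5, 0, 0), (6, 0, 0), (7, 0, 0), (8, 0, 0)],
      [(1, 1, 0), (4, 0, 0), (2, 0, 0), (8, 0, 0), (0, 0, 0)],
      [(1, 1, 0), (0, -1, 1), (5, 0, 0), (2, 0, 0), (3, 0, 0)],
      [(4, 0, 0), (0, -1, 1), (1, 0, 0), (6, 0, 0), (2, 0, 0)],
      [(2, 0, 0), (5, 0, 0), (1, 0, 0), (0, -1, 0), (7, 0, 0)],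
      [(8, 0, 0), (2, 0, 0), (6, 0, 0), (0, -1, 0), (1, 1, -1)],
      [(0, 0, 0), (3, 0, 0), (2, 0, 0), (7, 0, 0), (1, 1, -1)]] :: label list list"
  interpret periodic_data ?u ?v ?ds ?U ?V ?as ?nb
  proof
    show "approx ?u ?U" "approx ?v ?V"
      using bounds by (simp_all add: approx_def abs_le_iff)
    show "list_all2 (\<lambda>D A. approx (centre D) (fst A) \<and> 0 < radius D \<and> 1000 * radius D \<le> of_int (snd A)) ?ds ?as"
      using bounds by (simp add: approx_def abs_le_iff)
    show "packing_check ?U ?V ?as ?nb" by code_simp
    show "\<forall>(k, e)\<in>set (edges ?nb).
      (Re (offset ?u ?v ?ds k e))^2 + (Im (offset ?u ?v ?ds k e))^2 = (radius (?ds ! k) + radius (?ds ! fst e))^2"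
      by (simp add: edges_def offset_def upt_rec; (intro conjI)?;
          (fact rel | use rel in algebra | simp add: power2_eq_square algebra_simps))
  qed
  have "radius ` set ?ds = {1, r}" by auto
  thus ?thesis using compact by blast
qed

text \<open>Twelve small discs surround each large disc; the second relation puts their centres at
  distance \<open>1 + r\<close> from its centre.\<close>

lemma packing_c6:
  fixes r b :: real
  assumes rel: "b^2 = 3 * r^2" "(1 + r)^2 = 8 * r^2 + 4 * r * b"
    and bounds: "3491/10000 \<le> r" "r \<le> 3492/10000"
      "6048/10000 \<le> b" "b \<le> 6049/10000"
  shows "\<exists>P. compact_packing_using 1 r P"
proof -
  let ?u = "Complex (4 * r + 2 * b) 0" and ?v = "Complex (2 * r + b) (3 * r + 2 * b)"
  let ?ds = "[(Complex 0 0, 1),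
      (Complex (2 * r + b) r, r),
      (Complex (2 * r + b) (-r), r),
      (Complex (r + b) (r + b), r),
      (Complex r (2 * r + b), r),
      (Complex (- r) (2 * r + b), r),
      (Complex (-r - b) (r + b), r)]"
  let ?U = "(2606, 0) :: int \<times> int" and ?V = "(1303, 2257) :: int \<times> int"
  let ?as = "[((0, 0), 1000), ((1303, 349), 350), ((1303, -349), 350), ((954, 954), 350), ((349, 1303), 350), ((-349, 1303), 350), ((-954, 954), 350)] :: ((int \<times> int) \<times> int) list"
  let ?nb = "[[(1, 0, 0), (3, 0, 0), (4, 0, 0), (5, 0, 0), (6, 0, 0), (1, -1, 0), (2, -1, 0), (4, 0, -1), (3, 0, -1), (6, 1, -1), (5, 1, -1), (2, 0, 0)],
      [(6, 1, 0), (3, 0, 0), (0, 0, 0), (2, 0, 0), (0, 1, 0)],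
      [(0, 1, 0), (1, 0, 0), (0, 0, 0), (5, 1, -1), (4, 1, -1)],
      [(0, 0, 1), (4, 0, 0), (0, 0, 0), (1, 0, 0), (6, 1, 0)],
      [(0, 0, 1), (2, -1, 1), (5, 0, 0), (0, 0, 0), (3, 0, 0)],
      [(2, -1, 1), (0, -1, 1), (6, 0, 0), (0, 0, 0), (4, 0, 0)],
      [(5, 0, 0), (0, -1, 1), (3, -1, 0), (1, -1, 0), (0, 0, 0)]] :: label list list"
  interpret periodic_data ?u ?v ?ds ?U ?V ?as ?nb
  proof
    show "approx ?u ?U" "approx ?v ?V"
      using bounds by (simp_all add: approx_def abs_le_iff)
    show "list_all2 (\<lambda>D A. approx (centre D) (fst A) \<and> 0 < radius D \<and> 1000 * radius D \<le> of_int (snd A)) ?ds ?as"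
      using bounds by (simp add: approx_def abs_le_iff)
    show "packing_check ?U ?V ?as ?nb" by code_simp
    show "\<forall>(k, e)\<in>set (edges ?nb).
      (Re (offset ?u ?v ?ds k e))^2 + (Im (offset ?u ?v ?ds k e))^2 = (radius (?ds ! k) + radius (?ds ! fst e))^2"
      by (simp add: edges_def offset_def upt_rec; (intro conjI)?;
          (fact rel | use rel in algebra | simp add: power2_eq_square algebra_simps))
  qed
  have "radius ` set ?ds = {1, r}" by auto
  thus ?thesis using compact by blast
qed

text \<open>The second relation says that \<open>?u\<close> and \<open>?v\<close> have length 2, so
  that each large disc touches its translates by them.\<close>

lemma packing_c7:
  fixes r a :: real
  assumes rel: "a^2 = 1 + 2 * r" "2 * r^2 + 3 * r - 1 = 0"
    and bounds: "2807/10000 \<le> r" "r \<le> 2808/10000"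
      "12496/10000 \<le> a" "a \<le> 12497/10000"
  shows "\<exists>P. compact_packing_using 1 r P"
proof -
  let ?u = "Complex (1 + 2 * r) a" and ?v = "Complex (1 + 2 * r) (-a)"
  let ?ds = "[(Complex 0 a, 1),
      (Complex r 0, r),
      (Complex (- r) 0, r)]"
  let ?U = "(1562, 1250) :: int \<times> int" and ?V = "(1562, -1250) :: int \<times> int"
  let ?as = "[((0, 1250), 1000), ((281, 0), 282), ((-281, 0), 282)] :: ((int \<times> int) \<times> int) list"
  let ?nb = "[[(0, 1, 0), (1, 1, -1), (2, 1, -1), (0, 0, -1), (1, 0, -1), (0, -1, 0), (2, 0, 0), (1, 0, 0), (0, 0, 1), (2, 1, 0)],
      [(0, 0, 0), (2, 0, 0), (0, -1, 1), (0, 0, 1)],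
      [(0, 0, 0), (0, -1, 0), (0, -1, 1), (1, 0, 0)]] :: label list list"
  interpret periodic_data ?u ?v ?ds ?U ?V ?as ?nb
  proof
    show "approx ?u ?U" "approx ?v ?V"
      using bounds by (simp_all add: approx_def abs_le_iff)
    show "list_all2 (\<lambda>D A. approx (centre D) (fst A) \<and> 0 < radius D \<and> 1000 * radius D \<le> of_int (snd A)) ?ds ?as"
      using bounds by (simp add: approx_def abs_le_iff)
    show "packing_check ?U ?V ?as ?nb" by code_simp
    show "\<forall>(k, e)\<in>set (edges ?nb).
      (Re (offset ?u ?v ?ds k e))^2 + (Im (offset ?u ?v ?ds k e))^2 = (radius (?ds ! k) + radius (?ds ! fst e))^2"
      by (simp add: edges_def offset_def upt_rec; (intro conjI)?;
          (fact rel | use rel in algebra | simp add: power2_eq_square algebra_simps))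
  qed
  have "radius ` set ?ds = {1, r}" by auto
  thus ?thesis using compact by blast
qed

text \<open>Hexagonal packing of large discs with a small disc in every hole; \<open>2 * j\<close>
  is the distance from the centre of a hole to the large centres around it.\<close>

lemma packing_c8:
  fixes r j :: real
  assumes rel: "3 * j^2 = 1" "r = 2 * j - 1"
    and bounds: "1547/10000 \<le> r" "r \<le> 1548/10000"
      "5773/10000 \<le> j" "j \<le> 5774/10000"
  shows "\<exists>P. compact_packing_using 1 r P"
proof -
  let ?u = "Complex 2 0" and ?v = "Complex 1 (3 * j)"
  let ?ds = "[(Complex 0 0, 1),
      (Complex 1 j, r),
      (Complex 0 (2 * j), r)]"
  let ?U = "(2000, 0) :: int \<times> int" and ?V = "(1000, 1732) :: int \<times> int"
  let ?as = "[((0, 0), 1000), ((1000, 577), 156), ((0, 1155), 156)] :: ((int \<times> int) \<times> int) list"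
  let ?nb = "[[(1, 0, 0), (0, 0, 1), (2, 0, 0), (0, -1, 1), (1, -1, 0), (0, -1, 0), (2, 0, -1), (0, 0, -1), (1, 0, -1), (0, 1, -1), (2, 1, -1), (0, 1, 0)],
      [(0, 0, 1), (0, 0, 0), (0, 1, 0)],
      [(0, 0, 1), (0, -1, 1), (0, 0, 0)]] :: label list list"
  interpret periodic_data ?u ?v ?ds ?U ?V ?as ?nb
  proof
    show "approx ?u ?U" "approx ?v ?V"
      using bounds by (simp_all add: approx_def abs_le_iff)
    show "list_all2 (\<lambda>D A. approx (centre D) (fst A) \<and> 0 < radius D \<and> 1000 * radius D \<le> of_int (snd A)) ?ds ?as"
      using bounds by (simp add: approx_def abs_le_iff)
    show "packing_check ?U ?V ?as ?nb" by code_simp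
    show "\<forall>(k, e)\<in>set (edges ?nb).
      (Re (offset ?u ?v ?ds k e))^2 + (Im (offset ?u ?v ?ds k e))^2 = (radius (?ds ! k) + radius (?ds ! fst e))^2"
      by (simp add: edges_def offset_def upt_rec; (intro conjI)?;
          (fact rel | use rel in algebra | simp add: power2_eq_square algebra_simps))
  qed
  have "radius ` set ?ds = {1, r}" by auto
  thus ?thesis using compact by blast
qed

text \<open>Three mutually tangent small discs sit in every hole of the hexagonal packing, at
  distance \<open>2 * p\<close> from its centre. The quadratic relation is their contact with the
  large discs.\<close>

lemma packing_c9:
  fixes r j p :: real
  assumes rel: "3 * j^2 = 1" "p = j * r" "r^2 - 10 * r + 1 = 0"
    and bounds: "1010/10000 \<le> r" "r \<le> 1011/10000"
      "5773/10000 \<le> j" "j \<le> 5774/10000"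
      "583/10000 \<le> p" "p \<le> 584/10000"
  shows "\<exists>P. compact_packing_using 1 r P"
proof -
  let ?u = "Complex 2 0" and ?v = "Complex 1 (3 * j)"
  let ?ds = "[(Complex 0 0, 1),
      (Complex 1 (j - 2 * p), r),
      (Complex (1 + r) (j + p), r),
      (Complex (1 - r) (j + p), r),
      (Complex 0 (2 * j + 2 * p), r),
      (Complex r (2 * j - p), r),
      (Complex (- r) (2 * j - p), r)]"
  let ?U = "(2000, 0) :: int \<times> int" and ?V = "(1000, 1732) :: int \<times> int"
  let ?as = "[((0, 0), 1000), ((1000, 461), 102), ((1101, 636), 102), ((899, 636), 102), ((0, 1271), 102), ((101, 1096), 102), ((-101, 1096), 102)] :: ((int \<times> int) \<times> int) list"
  let ?nb = "[[(1, 0, 0), (3, 0, 0), (0, 0, 1), (5, 0, 0), (6, 0, 0), (0, -1, 1), (2, -1, 0), (1, -1, 0), (0, -1, 0), (4, 0, -1), (5, 0, -1), (0, 0, -1), (3, 0, -1), (2, 0, -1), (0, 1, -1), (6, 1, -1), (4, 1, -1), (0, 1, 0)],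
      [(2, 0, 0), (3, 0, 0), (0, 0, 0), (0, 1, 0)],
      [(0, 0, 1), (3, 0, 0), (1, 0, 0), (0, 1, 0)],
      [(0, 0, 1), (0, 0, 0), (1, 0, 0), (2, 0, 0)],
      [(0, 0, 1), (0, -1, 1), (6, 0, 0), (5, 0, 0)],
      [(0, 0, 1), (4, 0, 0), (6, 0, 0), (0, 0, 0)],
      [(4, 0, 0), (0, -1, 1), (0, 0, 0), (5, 0, 0)]] :: label list list"
  interpret periodic_data ?u ?v ?ds ?U ?V ?as ?nb
  proof
    show "approx ?u ?U" "approx ?v ?V"
      using bounds by (simp_all add: approx_def abs_le_iff)
    show "list_all2 (\<lambda>D A. approx (centre D) (fst A) \<and> 0 < radius D \<and> 1000 * radius D \<le> of_int (snd A)) ?ds ?as"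
      using bounds by (simp add: approx_def abs_le_iff)
    show "packing_check ?U ?V ?as ?nb" by code_simp
    show "\<forall>(k, e)\<in>set (edges ?nb).
      (Re (offset ?u ?v ?ds k e))^2 + (Im (offset ?u ?v ?ds k e))^2 = (radius (?ds ! k) + radius (?ds ! fst e))^2"
      by (simp add: edges_def offset_def upt_rec; (intro conjI)?;
          (fact rel | use rel in algebra | simp add: power2_eq_square algebra_simps))
  qed
  have "radius ` set ?ds = {1, r}" by auto
  thus ?thesis using compact by blast
qed


section \<open>Contacts between small and large discs\<close>

text \<open>Law of cosines in the triangle of centres of three mutually tangent discs, for the angle
  at the disc of radius \<open>\<rho>\<close>.\<close>

definition tri_angle :: "real \<Rightarrow> real \<Rightarrow> real \<Rightarrow> real" where
  "tri_angle \<rho> \<sigma> \<tau> = arccos (((\<rho> + \<sigma>)^2 + (\<rho> + \<tau>)^2 - (\<sigma> + \<tau>)^2) / (2 * (\<rho> + \<sigma>) * (\<rho> + \<tau>)))"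

lemma tri_angle_commute: "tri_angle \<rho> \<sigma> \<tau> = tri_angle \<rho> \<tau> \<sigma>"
  by (simp add: tri_angle_def algebra_simps)

lemma tangent_commute: "tangent D E \<longleftrightarrow> tangent E D"
  by (simp add: tangent_def dist_commute add.commute)

lemma inner_tangent:
  assumes "tangent D A" "tangent D B" "tangent A B"
  shows "2 * ((centre A - centre D) \<bullet> (centre B - centre D)) =
    (radius D + radius A)^2 + (radius D + radius B)^2 - (radius A + radius B)^2"
proof -
  have "norm (centre A - centre D) = radius D + radius A" "norm (centre B - centre D) = radius D + radius B"
    "norm ((centre A - centre D) - (centre B - centre D)) = radius A + radius B"
    using assms by (simp_all add: tangent_def dist_norm norm_minus_commute)
  thus ?thesis using dot_norm_neg[of "centre A - centre D" "centre B - centre D"] by simp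
qed

lemma angle_at_tangent:
  assumes "tangent D A" "tangent D B" "tangent A B"
  shows "angle_at (centre D) (centre A) (centre B) = tri_angle (radius D) (radius A) (radius B)"
proof -
  have "norm (centre A - centre D) = radius D + radius A" "norm (centre B - centre D) = radius D + radius B"
    using assms by (simp_all add: tangent_def dist_norm norm_minus_commute)
  hence "angle_at (centre D) (centre A) (centre B) = arccos ((2 * ((centre A - centre D) \<bullet> (centre B - centre D))) /
      (2 * ((radius D + radius A) * (radius D + radius B))))"
    unfolding angle_at_def by (subst mult_divide_mult_cancel_left) auto
  thus ?thesis by (simp only: tri_angle_def inner_tangent[OF assms] mult.assoc)
qed

text \<open>Otherwise the point dividing the segment of centres in the ratio of the radii is
  interior to both discs.\<close>

lemma packing_dist:
  assumes "packing P" "D \<in> P" "E \<in> P" "D \<noteq> E"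
  shows "radius D + radius E \<le> dist (centre D) (centre E)"
proof (rule ccontr)
  assume "\<not> ?thesis"
  hence d: "dist (centre D) (centre E) < radius D + radius E" by simp
  have pos: "radius D > 0" "radius E > 0" using assms by (auto simp: packing_def)
  define t where "t = radius D / (radius D + radius E)"
  define x where "x = centre D + t *\<^sub>R (centre E - centre D)"
  have t: "0 < t" "t < 1" "t * (radius D + radius E) = radius D" "(1 - t) * (radius D + radius E) = radius E"
    using pos by (auto simp: t_def field_simps)
  have "dist (centre D) x = t * dist (centre D) (centre E)"
    using t by (simp add: x_def dist_norm norm_minus_commute)
  hence 1: "dist (centre D) x < radius D" using d t by (metis mult_strict_left_mono)
  have "centre E - x = (1 - t) *\<^sub>R (centre E - centre D)" by (simp add: x_def algebra_simps)
  hence "dist (centre E) x = (1 - t) * dist (centre D) (centre E)"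
    using t by (simp add: dist_norm norm_minus_commute)
  hence 2: "dist (centre E) x < radius E" using d t by (metis diff_gt_0_iff_gt mult_strict_left_mono)
  have "interior (region D) \<inter> interior (region E) = {}"
    using assms by (auto simp: packing_def pairwise_def)
  thus False using 1 2 by (auto simp: region_def interior_cball)
qed

text \<open>By the law of cosines the angle sum depends on the radii alone, which makes it a
  combinatorial condition on the corona.\<close>

lemma surrounded_ring:
  assumes "surrounded P D"
  shows "\<exists>Ds. distinct Ds \<and> set Ds = {E \<in> P. tangent D E} \<and>
    cyclically_ordered (centre D) (map centre Ds) \<and>
    (\<forall>i<length Ds. tangent (Ds ! i) (Ds ! (Suc i mod length Ds))) \<and>
    (\<Sum>i<length Ds. tri_angle (radius D) (radius (Ds ! i)) (radius (Ds ! (Suc i mod length Ds)))) = 2 * pi"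
proof -
  obtain Ds where Ds: "distinct Ds" "set Ds = {E \<in> P. tangent D E}"
    "cyclically_ordered (centre D) (map centre Ds)"
    "\<And>i. i < length Ds \<Longrightarrow> tangent (Ds ! i) (Ds ! (Suc i mod length Ds))"
    "(\<Sum>i < length Ds. angle_at (centre D) (centre (Ds ! i)) (centre (Ds ! (Suc i mod length Ds)))) = 2 * pi"
    using assms unfolding surrounded_def by blast
  have "tangent D (Ds ! i)" if "i < length Ds" for i using Ds(2) that nth_mem by blast
  moreover have "Suc i mod length Ds < length Ds" if "i < length Ds" for i
    using that by (intro mod_less_divisor) linarith
  ultimately have "(\<Sum>i<length Ds. tri_angle (radius D) (radius (Ds ! i)) (radius (Ds ! (Suc i mod length Ds)))) = 2 * pi"
    using Ds(4,5) by (simp add: angle_at_tangent)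
  with Ds(1-4) show ?thesis by blast
qed

lemma arccos_half: "arccos (1 / 2) = pi / 3"
  using arccos_cos[of "pi / 3"] by (simp add: cos_60)

lemma tri_angle_equal: "\<rho> > 0 \<Longrightarrow> tri_angle \<rho> \<rho> \<rho> = pi / 3"
proof -
  assume "\<rho> > 0"
  hence "tri_angle \<rho> \<rho> \<rho> = arccos (1 / 2)"
    by (simp add: tri_angle_def power2_eq_square field_simps)
  thus ?thesis by (simp only: arccos_half)
qed

section \<open>Moving through small discs that touch only small discs\<close>

lemma cos_eq_half:
  assumes "cos d = 1 / 2" "0 < d" "d < 2 * pi"
  shows "d = pi / 3 \<or> d = 5 * pi / 3"
proof (cases "d \<le> pi")
  case True
  thus ?thesis using cos_inj_pi[of d "pi / 3"] assms by (simp add: cos_60)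
next
  case False
  have "cos (2 * pi - d) = 1 / 2" using assms by (simp add: cos_diff)
  hence "2 * pi - d = pi / 3" using False assms cos_inj_pi[of "2 * pi - d" "pi / 3"] by (simp add: cos_60)
  thus ?thesis by simp
qed

text \<open>Three consecutive squared cosines sum to \<open>3 / 2\<close>, so one of these squares is at least \<open>1 / 2\<close>; the remaining
  three vectors are the opposite ones, which takes care of the sign.\<close>

lemma hexagon_direction: "\<exists>k<6. cos (t + real k * pi / 3) \<ge> 1 / 2"
proof (rule ccontr)
  assume "\<not> ?thesis"
  hence *: "cos (t + real k * pi / 3) < 1 / 2" if "k < 6" for k using that by force
  have opp: "cos (x + pi) = - cos x" for x :: real by simp
  have a: "\<bar>cos (t + real k * pi / 3)\<bar> < 1 / 2" if "k < 3" for k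
  proof -
    have "cos (t + real (k + 3) * pi / 3) = - cos (t + real k * pi / 3)"
      using opp[of "t + real k * pi / 3"] by (simp add: algebra_simps add_divide_distrib)
    thus ?thesis using *[of k] *[of "k + 3"] that by linarith
  qed
  have sq: "(cos (t + real k * pi / 3))^2 < 1 / 4" if "k < 3" for k
    using power_strict_mono[OF a[OF that], of 2] by (simp add: power2_eq_square)
  define c s where "c = cos t" and "s = sin t"
  have 1: "cos (t + pi / 3) = c / 2 - s * sqrt 3 / 2"
    by (simp add: cos_add cos_60 sin_60 c_def s_def)
  have "cos (2 * pi / 3) = - 1 / 2" "sin (2 * pi / 3) = sqrt 3 / 2"
    using cos_double[of "pi / 3"] sin_double[of "pi / 3"]
    by (simp_all add: cos_60 sin_60 power2_eq_square)
  hence 2: "cos (t + 2 * pi / 3) = - c / 2 - s * sqrt 3 / 2"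
    by (simp add: cos_add c_def s_def)
  have cs: "c^2 + s^2 = 1" by (simp add: c_def s_def)
  have "(c / 2 - s * sqrt 3 / 2)^2 + (- c / 2 - s * sqrt 3 / 2)^2 = c^2 / 2 + 3 * s^2 / 2"
    by (simp add: power2_eq_square field_simps)
  hence "c^2 + (c / 2 - s * sqrt 3 / 2)^2 + (- c / 2 - s * sqrt 3 / 2)^2 = 3 / 2"
    using cs by simp
  moreover have "c^2 < 1 / 4" "(c / 2 - s * sqrt 3 / 2)^2 < 1 / 4" "(- c / 2 - s * sqrt 3 / 2)^2 < 1 / 4"
    using sq[of 0] sq[of 1] sq[of 2] by (simp_all add: 1 2 c_def)
  ultimately show False by linarith
qed

text \<open>All angles being pi/3, there are six neighbours, at distance \<open>2 * r\<close> and in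
  directions 60 degrees apart. One of them makes an angle of at most 60 degrees with
  \<open>z\<close>.\<close>

lemma hexagonal_step:
  assumes sur: "surrounded P E" and r: "radius E = r" "r > 0"
    and nbr: "\<And>F. F \<in> P \<Longrightarrow> tangent E F \<Longrightarrow> radius F = r"
  obtains F where "F \<in> P" "tangent E F" "(centre F - centre E) \<bullet> z \<ge> r * norm z"
proof -
  obtain Ds where Ds: "distinct Ds" "set Ds = {F \<in> P. tangent E F}"
    "cyclically_ordered (centre E) (map centre Ds)"
    "\<And>i. i < length Ds \<Longrightarrow> tangent (Ds ! i) (Ds ! (Suc i mod length Ds))"
    and ang: "(\<Sum>i<length Ds. tri_angle (radius E) (radius (Ds ! i)) (radius (Ds ! (Suc i mod length Ds)))) = 2 * pi"
    using surrounded_ring[OF sur] by blast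
  have rad: "radius (Ds ! i) = r" "tangent E (Ds ! i)" "Ds ! i \<in> P" if "i < length Ds" for i
    using nbr[of "Ds ! i"] Ds(2) that nth_mem by blast+
  have "(\<Sum>i<length Ds. tri_angle (radius E) (radius (Ds ! i)) (radius (Ds ! (Suc i mod length Ds)))) = (\<Sum>i<length Ds. pi / 3)"
  proof (intro sum.cong refl)
    fix i assume "i \<in> {..<length Ds}"
    hence "i < length Ds" "Suc i mod length Ds < length Ds" by (auto intro: mod_less_divisor)
    thus "tri_angle (radius E) (radius (Ds ! i)) (radius (Ds ! (Suc i mod length Ds))) = pi / 3"
      using rad(1) r tri_angle_equal by simp
  qed
  hence six: "length Ds = 6" using ang by simp
  obtain \<theta> where \<theta>: "\<And>i. i < 6 \<Longrightarrow> centre (Ds ! i) = centre E + rcis (dist (centre E) (centre (Ds ! i))) (\<theta> i)"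
    and ord: "\<And>i j. j < 6 \<Longrightarrow> i < j \<Longrightarrow> \<theta> i < \<theta> j \<and> \<theta> j < \<theta> i + 2 * pi"
    using Ds(3) by (auto simp: cyclically_ordered_def six)
  have w: "centre (Ds ! i) - centre E = rcis (2 * r) (\<theta> i)" if "i < 6" for i
    using \<theta>[OF that] rad(1,2)[of i] that r by (simp add: six tangent_def)
  have inc: "\<theta> (Suc i) - \<theta> i = pi / 3 \<or> \<theta> (Suc i) - \<theta> i = 5 * pi / 3" if "Suc i < 6" for i
  proof (rule cos_eq_half)
    have "tangent (Ds ! i) (Ds ! Suc i)" using Ds(4)[of i] that by (simp add: six)
    hence "2 * (rcis (2 * r) (\<theta> i) \<bullet> rcis (2 * r) (\<theta> (Suc i))) = 4 * r^2"
      using inner_tangent[of E "Ds ! i" "Ds ! Suc i"] rad[of i] rad[of "Suc i"] that r w[of i] w[of "Suc i"]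
      by (simp add: six power2_eq_square)
    thus "cos (\<theta> (Suc i) - \<theta> i) = 1 / 2" using r by (simp add: inner_polar power2_eq_square)
  qed (use ord[OF that, of i] in auto)
  have gaps: "\<theta> 1 - \<theta> 0 = pi / 3 \<or> \<theta> 1 - \<theta> 0 = 5 * pi / 3" "\<theta> 2 - \<theta> 1 = pi / 3 \<or> \<theta> 2 - \<theta> 1 = 5 * pi / 3"
    "\<theta> 3 - \<theta> 2 = pi / 3 \<or> \<theta> 3 - \<theta> 2 = 5 * pi / 3" "\<theta> 4 - \<theta> 3 = pi / 3 \<or> \<theta> 4 - \<theta> 3 = 5 * pi / 3"
    "\<theta> 5 - \<theta> 4 = pi / 3 \<or> \<theta> 5 - \<theta> 4 = 5 * pi / 3"
    using inc[of 0] inc[of 1] inc[of 2] inc[of 3] inc[of 4] by (simp_all add: eval_nat_numeral)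
  \<comment> \<open>A single gap of \<open>5 * pi / 3\<close> would bring the five gaps to at least
    3 pi.\<close>
  have "\<theta> 5 < \<theta> 0 + 2 * pi" using ord[of 5 0] by simp
  hence step: "\<theta> 1 = \<theta> 0 + pi / 3 \<and> \<theta> 2 = \<theta> 0 + 2 * pi / 3 \<and> \<theta> 3 = \<theta> 0 + 3 * pi / 3 \<and>
      \<theta> 4 = \<theta> 0 + 4 * pi / 3 \<and> \<theta> 5 = \<theta> 0 + 5 * pi / 3"
    using gaps pi_gt_zero by (elim disjE; intro conjI; linarith)
  have th: "\<theta> k = \<theta> 0 + real k * pi / 3" if "k < 6" for k
  proof -
    from that have "k = 0 \<or> k = 1 \<or> k = 2 \<or> k = 3 \<or> k = 4 \<or> k = 5" by linarith
    thus ?thesis using step by auto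
  qed
  obtain k where k: "k < 6" "cos (\<theta> 0 - Arg z + real k * pi / 3) \<ge> 1 / 2"
    using hexagon_direction by blast
  have z: "z = rcis (norm z) (Arg z)" by (simp add: rcis_cmod_Arg)
  have "(centre (Ds ! k) - centre E) \<bullet> z = 2 * r * norm z * cos (Arg z - \<theta> k)"
    using w[OF k(1)] z inner_polar by metis
  also have "cos (Arg z - \<theta> k) = cos (\<theta> 0 - Arg z + real k * pi / 3)"
    using cos_minus[of "Arg z - \<theta> k"] th[OF k(1)] by (simp add: algebra_simps)
  finally have eq: "(centre (Ds ! k) - centre E) \<bullet> z = 2 * r * norm z * cos (\<theta> 0 - Arg z + real k * pi / 3)" .
  have "2 * r * norm z * (1 / 2) \<le> 2 * r * norm z * cos (\<theta> 0 - Arg z + real k * pi / 3)"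
    using k(2) r by (intro mult_left_mono) auto
  hence "(centre (Ds ! k) - centre E) \<bullet> z \<ge> r * norm z" using eq by simp
  thus ?thesis using that[of "Ds ! k"] rad[of k] k(1) six by auto
qed

lemma exists_contact:
  assumes P: "compact_packing_using 1 r P" and r: "0 < r" "r < 1"
  shows "\<exists>D\<in>P. \<exists>E\<in>P. radius D = 1 \<and> radius E = r \<and> tangent E D"
proof (rule ccontr)
  assume "\<not> ?thesis"
  hence no: "\<not> tangent E D" if "D \<in> P" "E \<in> P" "radius D = 1" "radius E = r" for D E
    using that by blast
  have pk: "packing P" "\<And>D. D \<in> P \<Longrightarrow> surrounded P D" and img: "radius ` P = {1, r}"
    using P by (auto simp: compact_packing_using_def compact_packing_def)
  obtain D where D: "D \<in> P" "radius D = 1" using img by (metis imageE insertI1)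
  obtain E0 where E0: "E0 \<in> P" "radius E0 = r" using img by (metis imageE insertI1 insertI2)
  define f where "f E = (dist (centre E) (centre D))^2" for E
  have "\<exists>E\<in>P. radius E = r \<and> f E \<le> f E0 - real n * (2 * r * (1 - r))" for n
  proof (induction n)
    case 0
    thus ?case using E0 by auto
  next
    case (Suc n)
    then obtain E where E: "E \<in> P" "radius E = r" "f E \<le> f E0 - real n * (2 * r * (1 - r))" by blast
    have small: "radius F = r" if "F \<in> P" "tangent E F" for F
      using no[of F E] that E img by auto
    obtain F where F: "F \<in> P" "tangent E F"
      "(centre F - centre E) \<bullet> (centre D - centre E) \<ge> r * norm (centre D - centre E)"
      using hexagonal_step[OF pk(2)[OF E(1)] E(2) r(1) small] by metis
    define d where "d = dist (centre E) (centre D)"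
    have d: "1 + r \<le> d"
      using packing_dist[OF pk(1) E(1) D(1)] E(2) D(2) r(2) by (cases "E = D") (auto simp: d_def)
    have "dist (centre F) (centre D) = norm ((centre D - centre E) - (centre F - centre E))"
      by (simp add: dist_norm norm_minus_commute)
    hence "f F = (norm (centre D - centre E))^2 + (norm (centre F - centre E))^2
        - 2 * ((centre F - centre E) \<bullet> (centre D - centre E))"
      by (simp add: f_def power2_norm_eq_inner inner_diff_left inner_diff_right inner_commute)
    moreover have "norm (centre F - centre E) = 2 * r"
      using F(2) small[OF F(1,2)] E by (simp add: tangent_def dist_norm norm_minus_commute)
    ultimately have "f F \<le> d^2 + (2 * r)^2 - 2 * (r * d)"
      using F(3) by (simp add: d_def dist_norm norm_minus_commute)
    \<comment> \<open>As \<open>d\<close> is at least \<open>1 + r\<close>, the factor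
      \<open>d - 2 * r\<close> is at least \<open>1 - r\<close>, a gain independent of the
      step.\<close>
    also have "\<dots> = d^2 - 2 * r * (d - 2 * r)" by (simp add: power2_eq_square algebra_simps)
    also have "\<dots> \<le> d^2 - 2 * r * (1 - r)"
      using d r by (intro diff_left_mono mult_left_mono) auto
    also have "d^2 = f E" by (simp add: d_def f_def)
    finally have "f F \<le> f E0 - real (Suc n) * (2 * r * (1 - r))"
      using E(3) by (simp add: algebra_simps)
    thus ?case using F small by blast
  qed
  moreover obtain n where "real n * (2 * r * (1 - r)) > f E0"
    using reals_Archimedean3[of "2 * r * (1 - r)"] r by auto
  moreover have "f E \<ge> 0" for E by (simp add: f_def)
  ultimately show False by (smt (verit))
qed

section \<open>The possible coronas of a small disc\<close>

text \<open>\<open>True\<close> stands for a large neighbour. The entries count large-large, mixed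
  and small-small adjacent pairs, which contribute the angles \<alpha>, \<beta> and pi/3
  respectively.\<close>

definition corona_counts :: "bool list \<Rightarrow> nat \<times> nat \<times> nat" where
  "corona_counts bs = (let N = length bs; next = (\<lambda>i. bs ! (Suc i mod N)) in
     (length (filter (\<lambda>i. bs ! i \<and> next i) [0..<N]),
      length (filter (\<lambda>i. bs ! i \<noteq> next i) [0..<N]),
      length (filter (\<lambda>i. \<not> bs ! i \<and> \<not> next i) [0..<N])))"

lemma sum_corona_counts:
  fixes x y z :: real
  assumes "corona_counts bs = (a, b, c)"
  shows "(\<Sum>i<length bs. if bs ! i \<and> bs ! (Suc i mod length bs) then x
      else if bs ! i \<noteq> bs ! (Suc i mod length bs) then y else z) = a * x + b * y + c * z"
proof -
  have list: "sum_list (map (\<lambda>i. if p i \<and> q i then x else if p i \<noteq> q i then y else z) is) =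
      real (length (filter (\<lambda>i. p i \<and> q i) is)) * x + real (length (filter (\<lambda>i. p i \<noteq> q i) is)) * y
      + real (length (filter (\<lambda>i. \<not> p i \<and> \<not> q i) is)) * z" for p q and "is" :: "nat list"
    by (induction "is") (auto simp: algebra_simps)
  have "(\<Sum>i<length bs. if bs ! i \<and> bs ! (Suc i mod length bs) then x
      else if bs ! i \<noteq> bs ! (Suc i mod length bs) then y else z) =
    sum_list (map (\<lambda>i. if bs ! i \<and> bs ! (Suc i mod length bs) then x
      else if bs ! i \<noteq> bs ! (Suc i mod length bs) then y else z) [0..<length bs])"
    by (subst sum.distinct_set_conv_list[symmetric]) (auto simp: atLeast0LessThan)
  thus ?thesis using assms unfolding list by (auto simp: corona_counts_def Let_def)
qed

text \<open>The triples of all cyclic words of length 1 to 5 containing a large disc. The middle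
  entry is even because a cyclic word changes letter an even number of times.\<close>

definition short_counts :: "(nat \<times> nat \<times> nat) list" where
  "short_counts = [(0, 2, 0), (0, 2, 1), (0, 2, 2), (0, 2, 3), (0, 4, 0), (0, 4, 1), (1, 0, 0),
     (1, 2, 0), (1, 2, 1), (1, 2, 2), (1, 4, 0), (2, 0, 0), (2, 2, 0), (2, 2, 1), (3, 0, 0),
     (3, 2, 0), (4, 0, 0), (5, 0, 0)]"

text \<open>The other eight triples have angle sum below 2 pi. In the order listed, these ten lead
  to \<open>c8\<close>, \<open>c4\<close>, the impossible corona, \<open>c1\<close>,
  \<open>c2\<close>, \<open>c5\<close>, \<open>c7\<close>, \<open>c9\<close>, \<open>c3\<close> and
  \<open>c6\<close>.\<close>

definition feasible_counts :: "(nat \<times> nat \<times> nat) set" where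
  "feasible_counts = {(3, 0, 0), (4, 0, 0), (5, 0, 0), (3, 2, 0), (2, 2, 1), (1, 2, 2), (2, 2, 0),
     (1, 2, 1), (1, 4, 0), (0, 4, 1)}"

lemma short_coronas:
  assumes "length bs \<le> 5" "True \<in> set bs" "corona_counts bs = (a, b, c)"
  shows "(a, b, c) \<in> set short_counts" and "b = 0 \<Longrightarrow> False \<notin> set bs"
proof -
  have all: "\<forall>bs\<in>set (concat (map (\<lambda>n. List.n_lists n [True, False]) [0..<6])). True \<in> set bs \<longrightarrow>
    corona_counts bs \<in> set short_counts \<and> (fst (snd (corona_counts bs)) = 0 \<longrightarrow> False \<notin> set bs)"
    by code_simp
  have "bs \<in> set (List.n_lists (length bs) [True, False])" by (auto simp: set_n_lists)
  hence "bs \<in> set (concat (map (\<lambda>n. List.n_lists n [True, False]) [0..<6]))"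
    using assms(1) by (auto intro!: bexI[of _ "length bs"])
  from bspec[OF all this] assms(2,3)
  show "(a, b, c) \<in> set short_counts" and "b = 0 \<Longrightarrow> False \<notin> set bs"
    by simp_all
qed

section \<open>The angles at a small disc and the elimination of impossible coronas\<close>

locale two_radii =
  fixes r :: real
  assumes r: "0 < r" "r < 1"
begin

definition "\<alpha> = tri_angle r 1 1"
definition "\<beta> = tri_angle r 1 r"

text \<open>Half of the isosceles triangle is a right triangle with hypotenuse \<open>1 + r\<close>
  and leg 1 opposite the halved angle.\<close>

lemma alpha_eq: "\<alpha> = 2 * arcsin (1 / (1 + r))"
proof -
  define h where "h = arcsin (1 / (1 + r))"
  have b: "-1 \<le> 1 / (1 + r)" "1 / (1 + r) \<le> 1" "0 < 1 / (1 + r)" using r by (auto simp: field_simps)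
  have h: "sin h = 1 / (1 + r)" "h \<le> pi / 2"
    using sin_arcsin[OF b(1,2)] arcsin_ubound[OF b(1,2)] by (simp_all only: h_def)
  have h0: "0 \<le> h" using b arcsin_le_arcsin[of 0 "1 / (1 + r)"] by (simp add: h_def)
  have "((r + 1)^2 + (r + 1)^2 - (1 + 1)^2) / (2 * (r + 1) * (r + 1)) = 1 - 2 * (sin h)^2"
    using r by (simp add: h power2_eq_square divide_simps) (simp add: algebra_simps)
  also have "\<dots> = cos (2 * h)" by (simp add: cos_double_sin)
  finally show ?thesis using h h0 arccos_cos[of "2 * h"] by (simp add: \<alpha>_def tri_angle_def h_def)
qed

lemma beta_eq: "\<beta> = arccos (r / (1 + r))"
proof -
  have "((r + 1)^2 + (r + r)^2 - (1 + r)^2) / (2 * (r + 1) * (r + r)) = r / (1 + r)"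
    using r by (simp add: power2_eq_square divide_simps) (simp add: algebra_simps)
  thus ?thesis by (simp add: \<beta>_def tri_angle_def)
qed

lemma trig:
  "sin (\<alpha> / 2) = 1 / (1 + r)" "cos (\<alpha> / 2) = sqrt (r^2 + 2 * r) / (1 + r)"
  "cos \<beta> = r / (1 + r)" "sin \<beta> = sqrt (1 + 2 * r) / (1 + r)"
proof -
  have b: "-1 \<le> 1 / (1 + r)" "1 / (1 + r) \<le> 1" "-1 \<le> r / (1 + r)" "r / (1 + r) \<le> 1"
    using r by (auto simp: field_simps)
  show "sin (\<alpha> / 2) = 1 / (1 + r)" "cos \<beta> = r / (1 + r)"
    using sin_arcsin[OF b(1,2)] cos_arccos[OF b(3,4)] by (simp_all add: alpha_eq beta_eq)
  have 1: "1 - (1 / (1 + r))^2 = (r^2 + 2 * r) / (1 + r)^2"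
    "1 - (r / (1 + r))^2 = (1 + 2 * r) / (1 + r)^2"
    using r by (simp_all add: power2_eq_square divide_simps) (simp_all add: algebra_simps)
  have "cos (\<alpha> / 2) = sqrt (1 - (1 / (1 + r))^2)"
    using cos_arcsin[OF b(1,2)] by (simp add: alpha_eq)
  thus "cos (\<alpha> / 2) = sqrt (r^2 + 2 * r) / (1 + r)"
    using r by (simp only: 1 real_sqrt_divide real_sqrt_power) simp
  have "sin \<beta> = sqrt (1 - (r / (1 + r))^2)" unfolding beta_eq
    by (intro sin_arccos_abs abs_leI; use b in linarith)
  thus "sin \<beta> = sqrt (1 + 2 * r) / (1 + r)"
    using r by (simp only: 1 real_sqrt_divide real_sqrt_power) simp
qed

lemma angle_bounds: "pi / 3 < \<beta>" "\<beta> < pi / 2" "\<beta> < \<alpha>" "\<alpha> < pi"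
proof -
  have x: "r / (1 + r) < 1 / 2" "0 < r / (1 + r)" "r / (1 + r) \<le> 1" using r by (auto simp: field_simps)
  have "arccos (1 / 2) < arccos (r / (1 + r))" "arccos (r / (1 + r)) < arccos 0"
    by (intro arccos_less_arccos; use x in linarith)+
  thus "pi / 3 < \<beta>" and beta: "\<beta> < pi / 2" by (simp_all add: beta_eq arccos_half)
  have y: "1 / (1 + r) < 1" "0 < 1 / (1 + r)" using r by (auto simp: field_simps)
  have "arcsin (1 / (1 + r)) < arcsin 1" "arcsin 0 < arcsin (1 / (1 + r))"
    by (intro arcsin_less_arcsin; use y in linarith)+
  hence h: "0 < \<alpha>" "\<alpha> < pi" by (simp_all add: alpha_eq)
  thus "\<alpha> < pi" by simp
  have "cos \<alpha> = 1 - 2 * (1 / (1 + r))^2" using cos_double_sin[of "\<alpha> / 2"] by (simp add: trig)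
  also have "\<dots> < r / (1 + r)"
  proof -
    have "r / (1 + r) - (1 - 2 * (1 / (1 + r))^2) = (1 - r) / (1 + r)^2"
      using r by (simp add: power2_eq_square divide_simps) (simp add: algebra_simps)
    also have "\<dots> > 0" using r by simp
    finally show ?thesis by simp
  qed
  finally have "cos \<alpha> < cos \<beta>" by (simp add: trig)
  thus "\<beta> < \<alpha>"
    using cos_monotone_0_pi_le[of \<alpha> \<beta>] beta h by linarith
qed

lemma small_corona:
  assumes P: "compact_packing_using 1 r P" and D: "D \<in> P" "radius D = 1"
    and E: "E \<in> P" "radius E = r" "tangent E D"
  shows "\<exists>a b c :: nat. a * \<alpha> + b * \<beta> + c * (pi / 3) = 2 * pi \<and>
    (a, b, c) \<in> feasible_counts
    \<and> (b = 0 \<longrightarrow> (\<forall>F\<in>P. tangent E F \<longrightarrow> radius F = 1))"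
proof -
  have sur: "surrounded P E" and img: "radius ` P = {1, r}"
    using P E by (auto simp: compact_packing_using_def compact_packing_def)
  obtain Ds where Ds: "set Ds = {F \<in> P. tangent E F}"
    and sum: "(\<Sum>i<length Ds. tri_angle (radius E) (radius (Ds ! i)) (radius (Ds ! (Suc i mod length Ds)))) = 2 * pi"
    using surrounded_ring[OF sur] by blast
  define bs where "bs = map (\<lambda>F. radius F = 1) Ds"
  define N where "N = length Ds"
  have len: "length bs = N" by (simp add: bs_def N_def)
  have nxt: "Suc i mod N < N" if "i < N" for i using that by (intro mod_less_divisor) linarith
  have rad: "radius (Ds ! i) = (if bs ! i then 1 else r)" if "i < N" for i
  proof -
    have "Ds ! i \<in> P" using Ds that nth_mem unfolding N_def by blast
    hence "radius (Ds ! i) = 1 \<or> radius (Ds ! i) = r" using img by blast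
    thus ?thesis using that by (auto simp: bs_def N_def)
  qed
  define g where "g i = (if bs ! i \<and> bs ! (Suc i mod N) then \<alpha>
      else if bs ! i \<noteq> bs ! (Suc i mod N) then \<beta> else pi / 3)" for i
  have "(\<Sum>i<N. tri_angle (radius E) (radius (Ds ! i)) (radius (Ds ! (Suc i mod N)))) = (\<Sum>i<N. g i)"
    by (intro sum.cong refl)
      (use rad nxt r E tri_angle_equal[of r] tri_angle_commute[of r r 1] in \<open>auto simp: g_def \<alpha>_def \<beta>_def\<close>)
  hence g: "(\<Sum>i<N. g i) = 2 * pi" using sum by (simp add: N_def)
  have "D \<in> set Ds" using Ds D E by simp
  then obtain i where i: "i < N" "Ds ! i = D" by (auto simp: N_def in_set_conv_nth)
  hence bi: "bs ! i" using D by (simp add: bs_def N_def)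
  have "length bs \<le> 5"
  proof (rule ccontr)
    assume "\<not> ?thesis"
    hence "6 \<le> N" using len by simp
    \<comment> \<open>No angle is below pi/3, and the one following the large disc \<open>D\<close>
      is \<alpha> or \<beta>, hence larger.\<close>
    have "2 * pi \<le> (\<Sum>i<N. pi / 3)" using \<open>6 \<le> N\<close> by (simp add: field_simps)
    also have "\<dots> < (\<Sum>i<N. g i)"
      by (rule sum_strict_mono_ex1)
        (use angle_bounds bi i in \<open>auto simp: g_def intro!: bexI[of _ i]\<close>)
    finally show False using g by simp
  qed
  moreover have "True \<in> set bs" using bi i len nth_mem[of i bs] by simp
  moreover obtain a b c where abc: "corona_counts bs = (a, b, c)" by (cases "corona_counts bs")
  ultimately have cases: "(a, b, c) \<in> set short_counts" and all: "b = 0 \<Longrightarrow> False \<notin> set bs"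
    by (simp_all add: short_coronas[of bs a b c])
  have eq: "a * \<alpha> + b * \<beta> + c * (pi / 3) = 2 * pi"
    using sum_corona_counts[OF abc, of \<alpha> \<beta> "pi / 3"] g unfolding len g_def by (rule subst)
  have "(a, b, c) \<in> feasible_counts"
    using cases eq angle_bounds pi_gt_zero unfolding short_counts_def feasible_counts_def list.set
    by (elim insertE emptyE; simp; linarith?)
  moreover have "radius F = 1" if "b = 0" "F \<in> P" "tangent E F" for F
  proof -
    have "F \<in> set Ds" using that Ds by simp
    hence "(radius F = 1) \<in> set bs" by (auto simp: bs_def)
    thus ?thesis using all[OF that(1)] by metis
  qed
  ultimately show ?thesis using eq by blast
qed

lemma no_five_large:
  assumes P: "compact_packing_using 1 r P" and five: "5 * \<alpha> = 2 * pi"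
  shows False
proof -
  obtain D E where DE: "D \<in> P" "E \<in> P" "radius D = 1" "radius E = r" "tangent E D"
    using exists_contact[OF P r] by blast
  have img: "radius ` P = {1, r}" and sur: "surrounded P D"
    using P DE by (auto simp: compact_packing_using_def compact_packing_def)
  have only_large: "radius F = 1" if X: "X \<in> P" "radius X = r" "tangent X D" "F \<in> P" "tangent X F" for X F
  proof -
    obtain a b c :: nat where "a * \<alpha> + b * \<beta> + c * (pi / 3) = 2 * pi"
      "(a, b, c) \<in> feasible_counts"
      "b = 0 \<longrightarrow> (\<forall>F\<in>P. tangent X F \<longrightarrow> radius F = 1)"
      using small_corona[OF P DE(1,3) X(1-3)] by blast
    \<comment> \<open>With \<alpha> = 2 pi / 5, every feasible triple containing mixed pairs would
      force \<beta> \<ge> \<alpha>.\<close>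
    moreover from this have "b = 0"
      using five angle_bounds pi_gt_zero unfolding feasible_counts_def
      by (elim insertE emptyE; simp; linarith?)
    ultimately show ?thesis using X by blast
  qed
  obtain Ds where Ds: "set Ds = {F \<in> P. tangent D F}"
    and tan: "\<forall>i<length Ds. tangent (Ds ! i) (Ds ! (Suc i mod length Ds))"
    and sum: "(\<Sum>i<length Ds. tri_angle (radius D) (radius (Ds ! i)) (radius (Ds ! (Suc i mod length Ds)))) = 2 * pi"
    using surrounded_ring[OF sur] by blast
  define N where "N = length Ds"
  define p where "p i \<longleftrightarrow> radius (Ds ! i) = 1 \<and> radius (Ds ! (Suc i mod N)) = 1" for i
  have nxt: "Suc i mod N < N" if "i < N" for i using that by (intro mod_less_divisor) linarith
  have mem: "Ds ! i \<in> P" "tangent D (Ds ! i)" "radius (Ds ! i) = 1 \<or> radius (Ds ! i) = r" if "i < N" for i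
  proof -
    show m: "Ds ! i \<in> P" "tangent D (Ds ! i)" using Ds that nth_mem unfolding N_def by blast+
    thus "radius (Ds ! i) = 1 \<or> radius (Ds ! i) = r" using img by blast
  qed
  have not_both: "radius (Ds ! i) = 1 \<or> radius (Ds ! (Suc i mod N)) = 1" if "i < N" for i
    using only_large[of "Ds ! i" "Ds ! (Suc i mod N)"] mem[OF that] mem[OF nxt[OF that]] tan that
    by (auto simp: N_def tangent_commute)
  have half: "\<alpha> / 2 = pi / 5" using five by simp
  \<comment> \<open>The triangle large-large-small is isosceles, so its angle at a large disc is the
    complement of \<alpha> / 2.\<close>
  have "((1 + 1)^2 + (1 + r)^2 - (1 + r)^2) / (2 * (1 + 1) * (1 + r)) = 1 / (1 + r)"
    using r by (simp add: divide_simps)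
  hence "tri_angle 1 1 r = arccos (1 / (1 + r))" by (simp only: tri_angle_def)
  also have "1 / (1 + r) = sin (pi / 5)" using trig(1) half by simp
  also have "\<dots> = cos (3 * pi / 10)" using sin_cos_eq[of "pi / 5 :: real"] by simp
  also have "arccos \<dots> = 3 * pi / 10" by (subst arccos_cos) auto
  finally have gamma: "tri_angle 1 1 r = 3 * pi / 10" .
  have "2 * pi = (\<Sum>i<N. if p i then pi / 3 else 3 * pi / 10)"
    unfolding sum[symmetric] N_def[symmetric]
  proof (intro sum.cong refl)
    fix i assume "i \<in> {..<N}"
    hence i: "i < N" by simp
    show "tri_angle (radius D) (radius (Ds ! i)) (radius (Ds ! (Suc i mod N))) = (if p i then pi / 3 else 3 * pi / 10)"
      using mem(3)[OF i] mem(3)[OF nxt[OF i]] not_both[OF i] DE(3) gamma tri_angle_equal[of 1]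
        tri_angle_commute[of 1 r 1] r by (auto simp: p_def)
  qed
  also have "\<dots> = real (card {i. i < N \<and> p i}) * (pi / 3) + real (card {i. i < N \<and> \<not> p i}) * (3 * pi / 10)"
    by (simp add: sum.If_cases Collect_conj_eq lessThan_def Int_commute Compl_eq)
  finally have "real (10 * card {i. i < N \<and> p i} + 9 * card {i. i < N \<and> \<not> p i}) * pi = real 60 * pi"
    by (simp add: algebra_simps)
  hence "10 * card {i. i < N \<and> p i} + 9 * card {i. i < N \<and> \<not> p i} = 60"
    by (simp only: mult_cancel_right of_nat_eq_iff pi_neq_zero) simp
  moreover have "card {i. i < N \<and> \<not> p i} \<noteq> 0"
  proof -
    have "E \<in> set Ds" using Ds DE by (simp add: tangent_commute)
    then obtain i where "i < N" "Ds ! i = E" by (auto simp: N_def in_set_conv_nth)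
    hence "i \<in> {i. i < N \<and> \<not> p i}" using DE r by (simp add: p_def)
    moreover have "finite {i. i < N \<and> \<not> p i}" by simp
    ultimately show ?thesis unfolding card_eq_0_iff by blast
  qed
  ultimately show False by presburger
qed

end

section \<open>The roots\<close>

lemma ex1_root:
  fixes f :: "real \<Rightarrow> real"
  assumes "a < b" "continuous_on {a..b} f" "f a < 0" "f b > 0"
    and "\<And>x y. a < x \<Longrightarrow> x < y \<Longrightarrow> y < b \<Longrightarrow> f x = 0 \<Longrightarrow> f y \<noteq> 0"
  shows "\<exists>!x. x \<in> {a<..<b} \<and> f x = 0"
proof -
  obtain x where x: "a \<le> x" "x \<le> b" "f x = 0"
    using IVT'[of f a 0 b] assms by auto
  hence "x \<noteq> a" "x \<noteq> b" using assms by auto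
  show ?thesis
  proof (rule ex1I[of _ x])
    show "x \<in> {a<..<b} \<and> f x = 0" using x \<open>x \<noteq> a\<close> \<open>x \<noteq> b\<close> by auto
    fix y assume y: "y \<in> {a<..<b} \<and> f y = 0"
    show "y = x"
      using assms(5)[of x y] assms(5)[of y x] x y \<open>x \<noteq> a\<close> \<open>x \<noteq> b\<close>
      by (cases x y rule: linorder_cases) auto
  qed
qed

definition p1 :: "real \<Rightarrow> real" where "p1 x = x^4 - 10 * x^2 - 8 * x + 9"
definition p2 :: "real \<Rightarrow> real" where
  "p2 x = (7 + 4 * sqrt 3) * x^4 + (20 + 12 * sqrt 3) * x^3 + (6 + 4 * sqrt 3) * x^2
       + (- 20 - 4 * sqrt 3) * x + 3"
definition p3 :: "real \<Rightarrow> real" where "p3 x = 8 * x^3 + 3 * x^2 - 2 * x - 1"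

text \<open>After division by \<open>y - x\<close> the difference is
  \<open>8 + 10 * (x + y) - (x + y) * (x^2 + y^2)\<close>, whose last product is at most 4.\<close>

lemma p1_decreasing:
  assumes "0 \<le> x" "x < y" "y \<le> 1"
  shows "p1 y < p1 x"
proof -
  have "(x + y) * (x^2 + y^2) \<le> 2 * (1 + 1)"
    using assms by (intro mult_mono add_mono) (auto simp: power_le_one)
  hence "0 < (y - x) * (8 + 10 * (x + y) - (x + y) * (x^2 + y^2))"
    using assms by (intro mult_pos_pos) auto
  also have "\<dots> = p1 x - p1 y"
    by (simp add: p1_def algebra_simps power2_eq_square power4_eq_xxxx)
  finally show ?thesis by simp
qed

lemma sqrt3_bounds: "17320508 / 10000000 \<le> sqrt 3" "sqrt 3 \<le> 17320509 / 10000000"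
  by (rule real_le_rsqrt, simp add: power2_eq_square, rule real_le_lsqrt) (auto simp: power2_eq_square)

text \<open>The bound 1/2 matters: \<open>p2\<close> is 3 at 0 and negative at 1/2, so it is not
  increasing on the whole unit interval.\<close>

lemma p2_increasing:
  assumes "1 / 2 \<le> x" "x < y"
  shows "p2 x < p2 y"
proof -
  have xx: "1 / 4 \<le> x * x" "1 / 4 \<le> x * y" "1 / 4 \<le> y * y"
    using mult_mono[of "1/2" x "1/2" x] mult_mono[of "1/2" x "1/2" y] mult_mono[of "1/2" y "1/2" y] assms by auto
  have sq: "1 / 4 \<le> x^2 + y^2" using xx assms by (simp add: power2_eq_square)
  have "1 * (1 / 4) \<le> (x + y) * (x^2 + y^2)" using sq assms by (intro mult_mono) auto
  hence 1: "0 \<le> (7 + 4 * sqrt 3) * ((x + y) * (x^2 + y^2))" by simp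
  have 2: "(20 + 12 * sqrt 3) * (3 / 4) \<le> (20 + 12 * sqrt 3) * (x * x + x * y + y * y)"
    using xx by (intro mult_left_mono) auto
  have 3: "(6 + 4 * sqrt 3) * 1 \<le> (6 + 4 * sqrt 3) * (x + y)"
    using assms by (intro mult_left_mono) auto
  have "0 < (7 + 4 * sqrt 3) * ((x + y) * (x^2 + y^2)) + (20 + 12 * sqrt 3) * (x * x + x * y + y * y)
      + (6 + 4 * sqrt 3) * (x + y) - (20 + 4 * sqrt 3)"
    using 1 2 3 sqrt3_bounds by (simp add: algebra_simps)
  hence "0 < (y - x) * ((7 + 4 * sqrt 3) * ((x + y) * (x^2 + y^2)) + (20 + 12 * sqrt 3) * (x * x + x * y + y * y)
      + (6 + 4 * sqrt 3) * (x + y) - (20 + 4 * sqrt 3))"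
    using assms by (intro mult_pos_pos) auto
  also have "\<dots> = p2 y - p2 x"
    by (simp add: p2_def algebra_simps power2_eq_square power3_eq_cube power4_eq_xxxx)
  finally show ?thesis by simp
qed

text \<open>\<open>p3\<close> itself first decreases, but \<open>p3 x / x\<close> is increasing and
  has the same positive zeros.\<close>

lemma p3_increasing:
  assumes "0 < x" "x < y"
  shows "p3 x * y < p3 y * x"
proof -
  have "0 < (y - x) * (x * y * (8 * (x + y) + 3) + 1)"
    using assms by (intro mult_pos_pos add_pos_pos) auto
  also have "\<dots> = p3 y * x - p3 x * y"
    by (simp add: p3_def algebra_simps power2_eq_square power3_eq_cube)
  finally show ?thesis by simp
qed

lemma c1_ex1: "\<exists>!x. c1_root x"
proof -
  have "\<exists>!x. x \<in> {0<..<1} \<and> - p1 x = 0"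
  proof (rule ex1_root)
    show "continuous_on {0..1} (\<lambda>x. - p1 x)" unfolding p1_def by (intro continuous_intros)
    show "- p1 y \<noteq> 0" if "0 < x" "x < y" "y < 1" "- p1 x = 0" for x y
      using p1_decreasing[of x y] that by simp
  qed (simp_all add: p1_def)
  hence "\<exists>!x. x \<in> {0<..<1} \<and> p1 x = 0" by (simp only: neg_equal_0_iff_equal)
  thus ?thesis by (simp add: c1_root_def p1_def)
qed

lemma c2_ex1: "\<exists>!x. c2_root x"
proof -
  have "\<exists>!x. x \<in> {1/2<..<3/5} \<and> p2 x = 0"
  proof (rule ex1_root)
    show "continuous_on {1/2..3/5} p2" unfolding p2_def by (intro continuous_intros)
    show "p2 (1/2) < 0" "0 < p2 (3/5)"
      using sqrt3_bounds by (simp_all add: p2_def eval_nat_numeral field_simps)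
    show "p2 y \<noteq> 0" if "1/2 < x" "x < y" "y < 3/5" "p2 x = 0" for x y
      using p2_increasing[of x y] that by simp
  qed simp
  thus ?thesis by (simp add: c2_root_def p2_def)
qed

lemma c3_ex1: "\<exists>!x. c3_root x"
proof -
  have "\<exists>!x. x \<in> {0<..<1} \<and> p3 x = 0"
  proof (rule ex1_root)
    show "continuous_on {0..1} p3" unfolding p3_def by (intro continuous_intros)
    show "p3 y \<noteq> 0" if "0 < x" "x < y" "y < 1" "p3 x = 0" for x y
      using p3_increasing[of x y] that by auto
  qed (simp_all add: p3_def)
  thus ?thesis by (simp add: c3_root_def p3_def)
qed

lemma c1_iff: "r = c1 \<longleftrightarrow> 0 < r \<and> r < 1 \<and> p1 r = 0"
proof -
  have "r = c1 \<longleftrightarrow> c1_root r" unfolding c1_def using c1_ex1 theI' the1_equality by metis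
  thus ?thesis by (simp add: c1_root_def p1_def conj_assoc)
qed

lemma c2_iff: "r = c2 \<longleftrightarrow> 1 / 2 < r \<and> r < 3 / 5 \<and> p2 r = 0"
proof -
  have "r = c2 \<longleftrightarrow> c2_root r" unfolding c2_def using c2_ex1 theI' the1_equality by metis
  thus ?thesis by (simp add: c2_root_def p2_def conj_assoc)
qed

lemma c3_iff: "r = c3 \<longleftrightarrow> 0 < r \<and> r < 1 \<and> p3 r = 0"
proof -
  have "r = c3 \<longleftrightarrow> c3_root r" unfolding c3_def using c3_ex1 theI' the1_equality by metis
  thus ?thesis by (simp add: c3_root_def p3_def conj_assoc)
qed

lemma c1_bounds: assumes "r = c1" shows "637555 / 1000000 \<le> r" "r \<le> 637557 / 1000000"
proof -
  have r: "0 < r" "r < 1" "p1 r = 0" using assms by (auto simp: c1_iff)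
  have "p1 (637555 / 1000000) > 0" "p1 (637557 / 1000000) < 0" by (simp_all add: p1_def eval_nat_numeral)
  thus "637555 / 1000000 \<le> r" "r \<le> 637557 / 1000000"
    using p1_decreasing[of r "637555 / 1000000"] p1_decreasing[of "637557 / 1000000" r] r by fastforce+
qed

lemma c2_bounds: assumes "r = c2" shows "545150 / 1000000 \<le> r" "r \<le> 545152 / 1000000"
proof -
  have r: "1 / 2 < r" "r < 3 / 5" "p2 r = 0" using assms by (auto simp: c2_iff)
  have "p2 (545150 / 1000000) < 0" "p2 (545152 / 1000000) > 0"
    using sqrt3_bounds by (simp_all add: p2_def eval_nat_numeral field_simps)
  thus "545150 / 1000000 \<le> r" "r \<le> 545152 / 1000000"
    using p2_increasing[of r "545150 / 1000000"] p2_increasing[of "545152 / 1000000" r] r by fastforce+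
qed

lemma c3_bounds: assumes "r = c3" shows "533296 / 1000000 \<le> r" "r \<le> 533297 / 1000000"
proof -
  have r: "0 < r" "r < 1" "p3 r = 0" using assms by (auto simp: c3_iff)
  have "p3 (533296 / 1000000) < 0" "p3 (533297 / 1000000) > 0" by (simp_all add: p3_def eval_nat_numeral)
  thus "533296 / 1000000 \<le> r" "r \<le> 533297 / 1000000"
    using p3_increasing[of r "533296 / 1000000"] p3_increasing[of "533297 / 1000000" r] r
    by (fastforce simp: mult_less_0_iff zero_less_mult_iff)+
qed

section \<open>From coronas to radii\<close>

context two_radii
begin

text \<open>A name for the common denominator: with \<open>\<kappa> * (1 + r) = 1\<close> as a side
  relation, the trigonometric equations become polynomial.\<close>

definition "\<kappa> = 1 / (1 + r)"

lemma kappa: "\<kappa> * (1 + r) = 1"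
  using r by (simp add: \<kappa>_def)

lemma radical: "(sqrt (1 + 2 * r))^2 = 1 + 2 * r" "(sqrt (r^2 + 2 * r))^2 = r^2 + 2 * r"
  using r by simp_all

text \<open>Each angle equation below is solved for \<alpha> / 2, \<alpha> or \<beta>, so that these
  values and one trigonometric identity make it algebraic.\<close>

lemma trig_kappa:
  "sin (\<alpha> / 2) = \<kappa>" "cos (\<alpha> / 2) = sqrt (r^2 + 2 * r) * \<kappa>" "cos \<alpha> = 1 - 2 * \<kappa>^2"
  "cos \<beta> = r * \<kappa>" "sin \<beta> = sqrt (1 + 2 * r) * \<kappa>"
proof -
  show s: "sin (\<alpha> / 2) = \<kappa>" by (simp add: trig \<kappa>_def)
  show "cos \<alpha> = 1 - 2 * \<kappa>^2" using cos_double_sin[of "\<alpha> / 2"] s by simp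
qed (simp_all add: trig \<kappa>_def)

lemma eq_c8: assumes "3 * \<alpha> = 2 * pi" shows "r = c8"
proof -
  have half: "\<alpha> / 2 = pi / 3" using assms by simp
  have "\<kappa> = sqrt 3 / 2" using trig_kappa(1) unfolding half sin_60 by simp
  moreover have "(sqrt 3)^2 = 3" by simp
  ultimately have "3 * (1 + r) = 2 * sqrt 3" using kappa by algebra
  thus ?thesis by (simp add: c8_def)
qed

lemma eq_c4: assumes "4 * \<alpha> = 2 * pi" shows "r = c4"
proof -
  have half: "\<alpha> / 2 = pi / 4" using assms by simp
  have "\<kappa> = sqrt 2 / 2" using trig_kappa(1) unfolding half sin_45 by simp
  moreover have "(sqrt 2)^2 = 2" by simp
  ultimately have "1 + r = sqrt 2" using kappa by algebra
  thus ?thesis by (simp add: c4_def)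
qed

lemma eq_c7: assumes "2 * \<alpha> + 2 * \<beta> = 2 * pi" shows "r = c7"
proof -
  have "\<alpha> = pi - \<beta>" using assms by simp
  hence "cos \<alpha> = - cos \<beta>" by simp
  hence "1 - 2 * \<kappa>^2 = - (r * \<kappa>)" by (simp only: trig_kappa)
  hence "(4 * r + 3)^2 = 17" using kappa by algebra
  hence "sqrt 17 = 4 * r + 3" using r by (intro real_sqrt_unique) auto
  thus ?thesis by (simp add: c7_def)
qed

lemma eq_c6: assumes "4 * \<beta> + pi / 3 = 2 * pi" shows "r = c6"
proof -
  have \<beta>: "\<beta> = pi / 2 - pi / 12" using assms by simp
  have "sin (pi / 12) = cos \<beta>" unfolding \<beta> using sin_cos_eq[of "pi / 12 :: real"] by simp
  hence s: "sin (pi / 12) = r / (1 + r)" by (simp only: trig)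
  show ?thesis unfolding c6_def s using r by (simp add: divide_simps)
qed

lemma eq_c3: assumes "\<alpha> + 4 * \<beta> = 2 * pi" shows "r = c3"
proof -
  have half: "\<alpha> / 2 = pi - 2 * \<beta>" using assms by simp
  have "sin (\<alpha> / 2) = sin (2 * \<beta>)" unfolding half by (rule sin_pi_minus)
  hence "\<kappa> = 2 * (sqrt (1 + 2 * r) * \<kappa>) * (r * \<kappa>)"
    by (simp only: sin_double trig_kappa)
  hence "(1 + r)^2 = 4 * r^2 * (1 + 2 * r)" using kappa radical(1) by algebra
  hence "p3 r = 0" by (simp add: p3_def power2_eq_square power3_eq_cube algebra_simps)
  thus ?thesis using r by (simp add: c3_iff)
qed

lemma eq_c5: assumes "\<alpha> + 2 * \<beta> + 2 * (pi / 3) = 2 * pi" shows "r = c5"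
proof -
  have half: "\<alpha> / 2 = pi - (pi / 3 + \<beta>)" using assms by simp
  have "sin (\<alpha> / 2) = sin (pi / 3 + \<beta>)" unfolding half by (rule sin_pi_minus)
  hence "\<kappa> = sqrt 3 / 2 * (r * \<kappa>) + 1 / 2 * (sqrt (1 + 2 * r) * \<kappa>)"
    by (simp only: sin_add trig_kappa sin_60 cos_60)
  moreover have "(sqrt 3)^2 = 3" by simp
  ultimately have "(2 * sqrt 3 + 1 - 3 * r)^2 = 4 * (1 + sqrt 3)"
    using kappa radical(1) by algebra
  hence "(2 * sqrt 3 + 1 - 3 * r)^2 = (2 * sqrt (1 + sqrt 3))^2"
    by (simp add: power_mult_distrib)
  moreover have "0 \<le> 2 * sqrt 3 + 1 - 3 * r" using r sqrt3_bounds by linarith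
  ultimately have "2 * sqrt 3 + 1 - 3 * r = 2 * sqrt (1 + sqrt 3)"
    by (rule power2_eq_imp_eq) simp
  thus ?thesis by (simp add: c5_def)
qed

lemma eq_c9: assumes "\<alpha> + 2 * \<beta> + pi / 3 = 2 * pi" shows "r = c9"
proof -
  have half: "\<alpha> / 2 = pi - (pi / 6 + \<beta>)" using assms by simp
  have "sin (\<alpha> / 2) = sin (pi / 6 + \<beta>)" unfolding half by (rule sin_pi_minus)
  hence "\<kappa> = 1 / 2 * (r * \<kappa>) + sqrt 3 / 2 * (sqrt (1 + 2 * r) * \<kappa>)"
    by (simp only: sin_add trig_kappa sin_30 cos_30)
  moreover have "(sqrt 3)^2 = 3" by simp
  ultimately have "(5 - r)^2 = 24" using kappa radical(1) by algebra
  hence "(5 - r)^2 = (2 * sqrt 6)^2" by (simp add: power_mult_distrib)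
  moreover have "0 \<le> 5 - r" using r by simp
  ultimately have "5 - r = 2 * sqrt 6" by (rule power2_eq_imp_eq) simp
  thus ?thesis by (simp add: c9_def)
qed

lemma eq_c2: assumes "2 * \<alpha> + 2 * \<beta> + pi / 3 = 2 * pi" shows "r = c2"
proof -
  have \<alpha>: "\<alpha> = pi - (pi / 6 + \<beta>)" using assms by simp
  have "cos \<alpha> = - cos (pi / 6 + \<beta>)" unfolding \<alpha> by (rule cos_pi_minus)
  hence "1 - 2 * \<kappa>^2 = - (sqrt 3 / 2 * (r * \<kappa>) - 1 / 2 * (sqrt (1 + 2 * r) * \<kappa>))"
    by (simp only: cos_add trig_kappa sin_30 cos_30)
  hence eq: "2 * (1 + r)^2 - 4 + sqrt 3 * (r * (1 + r)) = (1 + r) * sqrt (1 + 2 * r)"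
    using kappa by algebra
  hence sq: "(2 * (1 + r)^2 - 4 + sqrt 3 * (r * (1 + r)))^2 = (1 + r)^2 * (1 + 2 * r)"
    using radical(1) by (simp add: power_mult_distrib)
  have expand: "(2 * (1 + r)^2 - 4 + s * (r * (1 + r)))^2 - (1 + r)^2 * (1 + 2 * r) =
    (4 + 4 * s + s^2) * r^4 + (14 + 12 * s + 2 * s^2) * r^3 + (3 + 4 * s + s^2) * r^2 + (- 20 - 4 * s) * r + 3" for s
    by algebra
  have "(4 + 4 * sqrt 3 + (sqrt 3)^2) * r^4 + (14 + 12 * sqrt 3 + 2 * (sqrt 3)^2) * r^3
      + (3 + 4 * sqrt 3 + (sqrt 3)^2) * r^2 + (- 20 - 4 * sqrt 3) * r + 3 = 0"
    unfolding expand[symmetric] using sq by simp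
  hence "p2 r = 0" by (simp add: p2_def)
  \<comment> \<open>Squaring has lost the sign, so \<open>r\<close> is located by the unsquared
    equation \<open>eq\<close>. Linear bounds on \<open>sqrt (1 + 2 * r)\<close>, valid on the
    respective side, contradict it outside (1/2, 3/5).\<close>
  moreover have "1 / 2 < r"
  proof (rule ccontr)
    assume "\<not> 1 / 2 < r"
    hence h: "r \<le> 1 / 2" by simp
    have rr: "r * r \<le> 1 / 2 * r" using h r by (intro mult_right_mono) auto
    have "(1 + 4 / 5 * r)^2 = 1 + 8 / 5 * r + 16 / 25 * (r * r)"
      by (simp add: power2_eq_square algebra_simps)
    hence "1 + 4 / 5 * r \<le> sqrt (1 + 2 * r)" using rr r by (intro real_le_rsqrt) linarith
    hence "(1 + r) * (1 + 4 / 5 * r) \<le> (1 + r) * sqrt (1 + 2 * r)" using r by (intro mult_left_mono) auto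
    moreover have "sqrt 3 * (r * (1 + r)) \<le> 174 / 100 * (r * (1 + r))"
      using sqrt3_bounds r by (intro mult_right_mono) auto
    moreover have "(1 + r) * (1 + 4 / 5 * r) = 1 + 9 / 5 * r + 4 / 5 * (r * r)"
      "2 * (1 + r)^2 = 2 + 4 * r + 2 * (r * r)" "174 / 100 * (r * (1 + r)) = 174 / 100 * r + 174 / 100 * (r * r)"
      by (simp_all add: power2_eq_square field_simps)
    ultimately show False using eq h r rr by linarith
  qed
  moreover have "r < 3 / 5"
  proof (rule ccontr)
    assume "\<not> r < 3 / 5"
    hence h: "3 / 5 \<le> r" by simp
    have rr: "3 / 5 * r \<le> r * r" using h r by (intro mult_right_mono) auto
    have "(1 + 82 / 100 * r)^2 = 1 + 164 / 100 * r + 6724 / 10000 * (r * r)"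
      by (simp add: power2_eq_square algebra_simps)
    hence "1 + 2 * r \<le> (1 + 82 / 100 * r)^2" using rr r by linarith
    hence "sqrt (1 + 2 * r) \<le> 1 + 82 / 100 * r" using r by (intro real_le_lsqrt) auto
    hence "(1 + r) * sqrt (1 + 2 * r) \<le> (1 + r) * (1 + 82 / 100 * r)" using r by (intro mult_left_mono) auto
    moreover have "173 / 100 * (r * (1 + r)) \<le> sqrt 3 * (r * (1 + r))"
      using sqrt3_bounds r by (intro mult_right_mono) auto
    moreover have "(1 + r) * (1 + 82 / 100 * r) = 1 + 182 / 100 * r + 82 / 100 * (r * r)"
      "2 * (1 + r)^2 = 2 + 4 * r + 2 * (r * r)" "173 / 100 * (r * (1 + r)) = 173 / 100 * r + 173 / 100 * (r * r)"
      by (simp_all add: power2_eq_square field_simps)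
    ultimately show False using eq h r rr by linarith
  qed
  ultimately show ?thesis by (simp add: c2_iff)
qed

lemma eq_c1: assumes "3 * \<alpha> + 2 * \<beta> = 2 * pi" shows "r = c1"
proof -
  define q where "q = sqrt (r^2 + 2 * r)"
  have q: "q^2 = r^2 + 2 * r" unfolding q_def by (rule radical)
  have \<beta>: "\<beta> = pi - 3 * (\<alpha> / 2)" using assms by simp
  have "cos \<beta> = - cos (3 * (\<alpha> / 2))" unfolding \<beta> by (rule cos_pi_minus)
  \<comment> \<open>The triple-angle formula for \<alpha> / 2. Squaring it later removes
    \<open>q\<close> and leaves \<open>p1 r\<close> with the nonzero factor
    \<open>2 * r\<close>.\<close>
  hence cubic: "r * \<kappa> = - (4 * (q * \<kappa>)^3 - 3 * (q * \<kappa>))"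
    by (simp only: cos_treble_cos trig_kappa q_def)
  have qk: "\<kappa>^2 * q^2 = 1 - \<kappa>^2" unfolding q using kappa by algebra
  have "4 * (q * \<kappa>)^3 - 3 * (q * \<kappa>) = \<kappa> * (q * (4 * (\<kappa>^2 * q^2) - 3))"
    by (simp add: power2_eq_square power3_eq_cube algebra_simps)
  hence "\<kappa> * r = \<kappa> * (q * (4 * \<kappa>^2 - 1))" using cubic unfolding qk by (simp add: algebra_simps)
  moreover have "\<kappa> \<noteq> 0" using r by (simp add: \<kappa>_def)
  ultimately have "r = q * (4 * \<kappa>^2 - 1)" by simp
  moreover have "q * (4 * \<kappa>^2 - 1) * (1 + r)^2 = q * (4 * (\<kappa> * (1 + r))^2 - (1 + r)^2)"
    by algebra
  ultimately have "r * (1 + r)^2 = q * (4 * (\<kappa> * (1 + r))^2 - (1 + r)^2)" by metis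
  hence "(r * (1 + r)^2)^2 = q^2 * (4 - (1 + r)^2)^2"
    by (simp only: kappa power_mult_distrib) simp
  hence "(r * (1 + r)^2)^2 = (r^2 + 2 * r) * (4 - (1 + r)^2)^2" by (simp only: q)
  hence "r * (2 * p1 r) = 0" unfolding p1_def by algebra
  thus ?thesis using r by (simp add: c1_iff)
qed

lemma radius_cases:
  assumes P: "compact_packing_using 1 r P"
  shows "r \<in> {c1, c2, c3, c4, c5, c6, c7, c8, c9}"
proof -
  obtain D E where DE: "D \<in> P" "E \<in> P" "radius D = 1" "radius E = r" "tangent E D"
    using exists_contact[OF P r] by blast
  obtain a b c :: nat where "a * \<alpha> + b * \<beta> + c * (pi / 3) = 2 * pi" "(a, b, c) \<in> feasible_counts"
    using small_corona[OF P DE(1,3,2,4,5)] by blast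
  thus ?thesis
    using eq_c1 eq_c2 eq_c3 eq_c4 eq_c5 eq_c6 eq_c7 eq_c8 eq_c9 no_five_large[OF P]
    unfolding feasible_counts_def by (elim insertE emptyE) auto
qed

end

section \<open>From radii to packings\<close>

lemma sqrt_between:
  shows "0 \<le> a \<Longrightarrow> a * a \<le> x \<Longrightarrow> a \<le> sqrt x"
    and "0 \<le> b \<Longrightarrow> x \<le> b * b \<Longrightarrow> sqrt x \<le> b"
  by (auto intro: real_le_rsqrt real_le_lsqrt simp: power2_eq_square)

lemma square_between:
  fixes x :: real
  assumes "0 \<le> a" "a \<le> x" "x \<le> b"
  shows "a * a \<le> x * x" "x * x \<le> b * b"
  using assms by (auto intro!: mult_mono)

lemma sqrt3_mult_between:
  assumes "0 \<le> a" "a \<le> x" "x \<le> b"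
  shows "17320508 / 10000000 * a \<le> sqrt 3 * x" "sqrt 3 * x \<le> 17320509 / 10000000 * b"
  using mult_mono[OF sqrt3_bounds(1) assms(2)] mult_mono[OF sqrt3_bounds(2) assms(3)] assms by simp_all

lemma exists_c1: "\<exists>P. compact_packing_using 1 c1 P"
proof -
  define r where "r = c1"
  have r: "637555 / 1000000 \<le> r" "r \<le> 637557 / 1000000" "0 < r" "r < 1" "p1 r = 0"
    using c1_bounds[OF r_def] c1_iff[of r] by (auto simp: r_def)
  define t q where "t = sqrt (1 + 2 * r)" and "q = sqrt (r^2 + 2 * r)"
  have t: "t^2 = 1 + 2 * r" and q: "q^2 = r^2 + 2 * r" using r by (simp_all add: t_def q_def)
  have rr: "637555 / 1000000 * (637555 / 1000000) \<le> r * r" "r * r \<le> 637557 / 1000000 * (637557 / 1000000)"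
    using square_between[OF _ r(1,2)] by simp_all
  have tb: "15083/10000 \<le> t" "t \<le> 15084/10000" unfolding t_def
    by (rule sqrt_between; use r in simp)+
  have qb: "12967/10000 \<le> q" "q \<le> 12968/10000" unfolding q_def power2_eq_square
    by (rule sqrt_between; use r rr in simp)+
  define K where "K = (1 + r)^2"
  \<comment> \<open>\<open>A\<close> and \<open>B\<close> are the sine and cosine forms of
    \<open>3 * \<alpha> + 2 * \<beta> = 2 * pi\<close>, cleared of denominators by \<open>K\<close>.
    The numerical bounds select the signs of the roots that \<open>p1 r = 0\<close> leaves
    open.\<close>
  have A: "t * K = 3 * K - 4"
  proof (rule power2_eq_imp_eq)
    have "(3 * K - 4)^2 - (1 + 2 * r) * K^2 = - (2 * r * p1 r)" unfolding K_def p1_def by algebra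
    thus "(t * K)^2 = (3 * K - 4)^2" using r t by (simp add: power_mult_distrib)
    show "0 \<le> 3 * K - 4" using rr r by (simp add: K_def power2_eq_square algebra_simps)
  qed (use r tb in \<open>simp add: K_def\<close>)
  have B: "r * K = q * ((1 - r) * (3 + r))"
  proof (rule power2_eq_imp_eq)
    have "(r^2 + 2 * r) * ((1 - r) * (3 + r))^2 - (r * K)^2 = 2 * r * p1 r" unfolding K_def p1_def by algebra
    thus "(r * K)^2 = (q * ((1 - r) * (3 + r)))^2" using r q by (simp add: power_mult_distrib)
  qed (use r qb in \<open>auto simp: K_def\<close>)
  have "(r^2 + 2 * r - 1 + r * q) * K = t * K"
  proof -
    have "(r^2 + 2 * r - 1 + r * q) * K = (r^2 + 2 * r - 1) * K + q * (r * K)" by (simp add: algebra_simps)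
    also have "\<dots> = (r^2 + 2 * r - 1) * K + q^2 * ((1 - r) * (3 + r))"
      unfolding B by (simp add: power2_eq_square)
    also have "\<dots> = 3 * K - 4" unfolding q K_def by algebra
    finally show ?thesis using A by simp
  qed
  moreover have "K \<noteq> 0" using r by (simp add: K_def)
  ultimately have rel: "r^2 + 2 * r - 1 + r * q = t" by simp
  have "\<exists>P. compact_packing_using 1 r P"
    by (rule packing_c1[of t r q]) (use t q rel r tb qb in simp_all)
  thus ?thesis by (simp add: r_def)
qed

lemma exists_c2: "\<exists>P. compact_packing_using 1 c2 P"
proof -
  define r where "r = c2"
  have r: "545150 / 1000000 \<le> r" "r \<le> 545152 / 1000000" "0 < r" "p2 r = 0"
    using c2_bounds[OF r_def] c2_iff[of r] by (auto simp: r_def)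
  define S t p where "S = sqrt 3" and "t = sqrt (1 + 2 * r)" and "p = S * r / 3"
  \<comment> \<open>These values solve the two contact equations between small and large discs. The
    hexagon relation remains, and it is where \<open>p2 r = 0\<close> enters.\<close>
  define a b where "a = (p + t) / 2" and "b = p + (1 + r) / 2"
  have S: "S^2 = 3" and t: "t^2 = 1 + 2 * r" using r by (simp_all add: S_def t_def)
  have p: "r = S * p" using S by (simp add: p_def power2_eq_square)
  have tb: "144578/100000 \<le> t" "t \<le> 144579/100000" unfolding t_def
    by (rule sqrt_between; use r in simp)+
  have Sr: "17320508 / 10000000 * (545150 / 1000000) \<le> S * r" "S * r \<le> 17320509 / 10000000 * (545152 / 1000000)"
    unfolding S_def using sqrt3_mult_between[OF _ r(1,2)] by simp_all
  have pb: "314741/1000000 \<le> p" "p \<le> 314744/1000000" using Sr by (simp_all add: p_def)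
  have dbl: "2 * a = p + t" "2 * b = 2 * p + 1 + r" by (simp_all add: a_def b_def)
  hence ab: "88026/100000 \<le> a" "a \<le> 88027/100000" "108731/100000 \<le> b" "b \<le> 108732/100000"
    using tb pb r(1,2) by linarith+
  have sb: "15246/10000 \<le> S * a" "S * a \<le> 15247/10000" "18832/10000 \<le> S * b" "S * b \<le> 18833/10000"
    unfolding S_def using sqrt3_mult_between[OF _ ab(1,2)] sqrt3_mult_between[OF _ ab(3,4)] by simp_all
  have eq: "2 * (1 + r)^2 - 4 + S * (r * (1 + r)) = (1 + r) * t"
  proof (rule power2_eq_imp_eq)
    have "(2 * (1 + r)^2 - 4 + S * (r * (1 + r)))^2 - (1 + r)^2 * (1 + 2 * r) =
      (4 + 4 * S + S^2) * r^4 + (14 + 12 * S + 2 * S^2) * r^3 + (3 + 4 * S + S^2) * r^2 + (- 20 - 4 * S) * r + 3"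
      by algebra
    also have "\<dots> = p2 r" unfolding S by (simp add: p2_def S_def)
    finally show "(2 * (1 + r)^2 - 4 + S * (r * (1 + r)))^2 = ((1 + r) * t)^2"
      using r t by (simp add: power_mult_distrib)
    have "0 \<le> r * r" "0 \<le> S * (r * r)" using r by (simp_all add: S_def)
    moreover have "2 * (1 + r)^2 - 4 + S * (r * (1 + r)) = 4 * r + 2 * (r * r) - 2 + S * r + S * (r * r)"
      by (simp add: power2_eq_square algebra_simps)
    ultimately show "0 \<le> 2 * (1 + r)^2 - 4 + S * (r * (1 + r))"
      using Sr(1) r(1) by linarith
  qed (use r tb in simp)
  have "4 * (a^2 - a * b + b^2) = 3 * p^2 + t^2 + 3 * p * (1 + r) + (1 + r)^2 - (1 + r) * t"
    by (simp add: a_def b_def power2_eq_square field_simps)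
  also have "\<dots> = r^2 + (1 + 2 * r) + S * r * (1 + r) + (1 + r)^2 - (2 * (1 + r)^2 - 4 + S * (r * (1 + r)))"
  proof -
    have "r^2 = 3 * p^2" using arg_cong[OF p, of "\<lambda>x. x^2"] by (simp add: power_mult_distrib S)
    moreover have "3 * p = S * r" by (simp add: p_def)
    ultimately show ?thesis by (simp only: t eq flip: \<open>r^2 = 3 * p^2\<close>)
  qed
  also have "\<dots> = 4" by (simp add: power2_eq_square algebra_simps)
  finally have hex: "a^2 - a * b + b^2 = 1" by simp
  have "\<exists>P. compact_packing_using 1 r P"
  proof (rule packing_c2[of "S * a" a "S * b" b r p])
    show "(S * a)^2 = 3 * a^2" "(S * b)^2 = 3 * b^2" by (simp_all add: power_mult_distrib S)
    have "S * a * (S * b) = S^2 * (a * b)" by (simp add: power2_eq_square)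
    thus "S * a * (S * b) = 3 * a * b" by (simp add: S)
    show "r^2 = 3 * p^2" using arg_cong[OF p, of "\<lambda>x. x^2"] by (simp add: power_mult_distrib S)
    show "r * (S * a) = 3 * p * a" "r * (S * b) = 3 * p * b" by (simp_all add: p_def)
    have "2 * a - p = t" by (simp add: a_def field_simps)
    thus "(2 * a - p)^2 + r^2 = (1 + r)^2" using t by (simp add: power2_eq_square algebra_simps)
  qed (use dbl(2) hex r pb ab sb in simp_all)
  thus ?thesis by (simp add: r_def)
qed

lemma exists_c3: "\<exists>P. compact_packing_using 1 c3 P"
proof -
  define r where "r = c3"
  have r: "533296 / 1000000 \<le> r" "r \<le> 533297 / 1000000" "0 < r" "r < 1" "p3 r = 0"
    using c3_bounds[OF r_def] c3_iff[of r] by (auto simp: r_def)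
  define q where "q = sqrt (r^2 + 2 * r)"
  have q: "q^2 = r^2 + 2 * r" using r by (simp add: q_def)
  have rr: "533296 / 1000000 * (533296 / 1000000) \<le> r * r" "r * r \<le> 533297 / 1000000 * (533297 / 1000000)"
    using square_between[OF _ r(1,2)] by simp_all
  have qb: "11623/10000 \<le> q" "q \<le> 11624/10000" unfolding q_def power2_eq_square
    by (rule sqrt_between; use r rr in simp)+
  have rel: "1 + 2 * r - r^2 = (1 + r) * q"
  proof (rule power2_eq_imp_eq)
    have "(1 + 2 * r - r^2)^2 - (1 + r)^2 * (r^2 + 2 * r) = - p3 r" unfolding p3_def by algebra
    thus "(1 + 2 * r - r^2)^2 = ((1 + r) * q)^2" using r q by (simp add: power_mult_distrib)
    show "0 \<le> 1 + 2 * r - r^2" using rr r by (simp add: power2_eq_square)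
  qed (use r qb in simp)
  have "\<exists>P. compact_packing_using 1 r P"
    by (rule packing_c3[of q r]) (use q rel r qb in simp_all)
  thus ?thesis by (simp add: r_def)
qed

lemma exists_c4: "\<exists>P. compact_packing_using 1 c4 P"
proof (rule packing_c4)
  have "14142/10000 \<le> sqrt 2" "sqrt 2 \<le> 14143/10000" by (rule sqrt_between; simp)+
  thus "4142/10000 \<le> c4" "c4 \<le> 4143/10000" by (simp_all add: c4_def)
qed (simp add: c4_def)

lemma exists_c5: "\<exists>P. compact_packing_using 1 c5 P"
proof -
  define S R where "S = sqrt 3" and "R = sqrt (1 + sqrt 3)"
  have S: "S^2 = 3" and R: "R^2 = 1 + S" by (simp_all add: S_def R_def)
  have Rb: "1652891/1000000 \<le> R" "R \<le> 1652892/1000000" unfolding R_def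
    by (rule sqrt_between; use sqrt3_bounds in simp)+
  have r: "c5 = (2 * S + 1 - 2 * R) / 3" by (simp add: c5_def S_def R_def)
  have rb: "386105/1000000 \<le> c5" "c5 \<le> 386107/1000000"
    using Rb sqrt3_bounds by (simp_all add: r S_def)
  show ?thesis
  proof (rule packing_c5[of "S / 3" "S * c5 / 3" c5])
    show "3 * (S / 3)^2 = 1" using S by (simp add: power_divide)
    have "3 * c5 = 2 * S + 1 - 2 * R" by (simp add: r)
    hence "(3 * c5 - 2 * S - 1)^2 = 4 * (1 + S)" using R by algebra
    thus "3 * c5^2 - 12 * (S * c5 / 3) - 2 * c5 + 3 = 0" using S by algebra
  qed (use rb sqrt3_bounds sqrt3_mult_between[OF _ rb] in \<open>simp_all add: S_def\<close>)
qed

lemma exists_c6: "\<exists>P. compact_packing_using 1 c6 P"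
proof -
  define S \<sigma> where "S = sqrt 3" and "\<sigma> = sin (pi / 12)"
  have S: "S^2 = 3" by (simp add: S_def)
  have pos: "0 < \<sigma>" unfolding \<sigma>_def by (intro sin_gt_zero) auto
  have "cos (pi / 6) = 1 - 2 * \<sigma>^2" using cos_double_sin[of "pi / 12"] by (simp add: \<sigma>_def)
  hence \<sigma>: "4 * \<sigma>^2 = 2 - S" by (simp add: cos_30 S_def)
  have "\<sigma> = sqrt ((2 - S) / 4)" using \<sigma> pos by (intro real_sqrt_unique[symmetric]) auto
  moreover have "258819/1000000 \<le> sqrt ((2 - S) / 4)" "sqrt ((2 - S) / 4) \<le> 258820/1000000"
    by (rule sqrt_between; use sqrt3_bounds in \<open>simp add: S_def\<close>)+
  ultimately have sb: "258819/1000000 \<le> \<sigma>" "\<sigma> \<le> 258820/1000000" by simp_all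
  have r: "c6 = \<sigma> / (1 - \<sigma>)" by (simp add: c6_def \<sigma>_def)
  have rb: "34919/100000 \<le> c6" "c6 \<le> 34920/100000"
    using sb by (simp_all add: r field_simps)
  show ?thesis
  proof (rule packing_c6[of "S * c6" c6])
    show "(S * c6)^2 = 3 * c6^2" by (simp add: power_mult_distrib S)
    have "c6 = \<sigma> * (1 + c6)" using sb by (simp add: r divide_simps)
    hence "c6^2 = \<sigma>^2 * (1 + c6)^2" by (metis power_mult_distrib)
    hence "4 * c6^2 = (2 - S) * (1 + c6)^2" by (simp flip: \<sigma>)
    moreover have "8 * c6^2 + 4 * c6 * (S * c6) = (2 + S) * (4 * c6^2)"
      by (simp add: power2_eq_square algebra_simps)
    \<comment> \<open>Since \<open>(2 + S) * (2 - S) = 1\<close>, multiplying by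
      \<open>2 + S\<close> inverts the half-angle relation for \<sigma>.\<close>
    moreover have "(2 + S) * ((2 - S) * y) = (4 - S^2) * y" for y
      by (simp add: power2_eq_square algebra_simps)
    ultimately show "(1 + c6)^2 = 8 * c6^2 + 4 * c6 * (S * c6)" by (simp add: S)
  qed (use rb sqrt3_mult_between[OF _ rb] in \<open>simp_all add: S_def\<close>)
qed

lemma exists_c7: "\<exists>P. compact_packing_using 1 c7 P"
proof -
  have "41231/10000 \<le> sqrt 17" "sqrt 17 \<le> 41232/10000" by (rule sqrt_between; simp)+
  hence rb: "28077/100000 \<le> c7" "c7 \<le> 28080/100000" by (simp_all add: c7_def)
  have ab: "12496/10000 \<le> sqrt (1 + 2 * c7)" "sqrt (1 + 2 * c7) \<le> 12497/10000"
    by (rule sqrt_between; use rb in simp)+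
  show ?thesis
  proof (rule packing_c7[of "sqrt (1 + 2 * c7)" c7])
    have "4 * c7 + 3 = sqrt 17" by (simp add: c7_def field_simps)
    hence "(4 * c7 + 3)^2 = 17" by simp
    thus "2 * c7^2 + 3 * c7 - 1 = 0" by (simp add: power2_eq_square algebra_simps)
  qed (use rb ab in simp_all)
qed

lemma exists_c8: "\<exists>P. compact_packing_using 1 c8 P"
  by (rule packing_c8[of "sqrt 3 / 3" c8])
    (use sqrt3_bounds in \<open>simp_all add: c8_def power_divide\<close>)

lemma exists_c9: "\<exists>P. compact_packing_using 1 c9 P"
proof -
  define S where "S = sqrt 3"
  have S: "S^2 = 3" by (simp add: S_def)
  have "2449489/1000000 \<le> sqrt 6" "sqrt 6 \<le> 2449490/1000000" by (rule sqrt_between; simp)+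
  hence rb: "101020/1000000 \<le> c9" "c9 \<le> 101022/1000000" by (simp_all add: c9_def)
  show ?thesis
  proof (rule packing_c9[of "S / 3" "S * c9 / 3" c9])
    show "3 * (S / 3)^2 = 1" using S by (simp add: power_divide)
    have "(5 - c9)^2 = 24" by (simp add: c9_def power_mult_distrib)
    thus "c9^2 - 10 * c9 + 1 = 0" by (simp add: power2_eq_square algebra_simps)
  qed (use rb sqrt3_bounds sqrt3_mult_between[OF _ rb] in \<open>simp_all add: S_def\<close>)
qed

text \<open>The unique existence statements belong to the result because \<open>c1\<close>,
  \<open>c2\<close> and \<open>c3\<close> are definite descriptions.\<close>

theorem theorem1:
  fixes r :: real
  assumes "r \<in> {0<..<1}"
  shows "(\<exists>!x. c1_root x) \<and> (\<exists>!x. c2_root x) \<and> (\<exists>!x. c3_root x) \<and>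
    ((\<exists>P. compact_packing_using 1 r P) \<longleftrightarrow> r \<in> {c1, c2, c3, c4, c5, c6, c7, c8, c9})"
proof -
  interpret two_radii r by standard (use assms in auto)
  have "(\<exists>P. compact_packing_using 1 r P) \<longleftrightarrow> r \<in> {c1, c2, c3, c4, c5, c6, c7, c8, c9}"
    using radius_cases exists_c1 exists_c2 exists_c3 exists_c4 exists_c5 exists_c6 exists_c7
      exists_c8 exists_c9 by auto
  thus ?thesis using c1_ex1 c2_ex1 c3_ex1 by blast
qed

end
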